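(* Let $\lambda$ be a partition with $|\lambda|=N$ and let $n\ge N$. For every $T\in\mathsf{SYT}(\lambda)$, the edges of the crystal skeleton $\mathsf{CS}(\lambda)$ leaving $T$ are in bijection with the Dyck pattern intervals of $\mathsf{row}(T)$; consequently the edges of $\mathsf{CS}(\lambda)$ are in bijection with the pairs $(T,I)$ where $T\in\mathsf{SYT}(\lambda)$ and $I$ is a Dyck pattern interval occurring in $\mathsf{row}(T)$.
   Context: Partitions and Young tableaux are drawn in French notation (row lengths weakly decrease from bottom to top). For a partition $\lambda$ with $|\lambda|=N$, $\mathsf{SYT}(\lambda)$ denotes the standard Young tableaux of shape $\lambda$ (entries $1,\dots,N$) and $\mathsf{SSYT}(\lambda)_n$ the semistandard Young tableaux of shape $\lambda$ with entries in $[n]=\{1,\dots,n\}$. The reading word $\mathsf{row}(b)$ of a tableau reads each row left to right, starting with the top row and ending with the bottom row. If $b$ has $a_j$ entries equal to $j$, its standardization $\mathsf{std}(b)$ replaces the entries equal to $j$, in reading-word order, by $a_1+\dots+a_{j-1}+1,\dots,a_1+\dots+a_j$; it is a standard tableau of the same shape. The crystal $B(\lambda)_n$ is the set $\mathsf{SSYT}(\lambda)_n$ with operators $f_i,e_i$ ($1\le i<n$) defined as follows: in the subword of $\mathsf{row}(b)$ consisting of the letters $i$ and $i+1$, successively bracket each letter $i+1$ with an unbracketed letter $i$ to its right (as with parentheses, $i+1$ opening and $i$ closing); the unbracketed letters form a word $i^r(i+1)^s$; $f_i$ changes the rightmost unbracketed $i$ to $i+1$ ($f_i(b)=\emptyset$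 if $r=0$) and $e_i$ changes the leftmost unbracketed $i+1$ to $i$ ($e_i(b)=\emptyset$ if $s=0$); other letters are unchanged. For $T\in\mathsf{SYT}(\lambda)$ the quasi-crystal is $Q_T=\{b\in B(\lambda)_n:\mathsf{std}(b)=T\}$. The crystal skeleton $\mathsf{CS}(\lambda)$ is the directed graph with vertex set $\mathsf{SYT}(\lambda)$ with an edge $T\to T'$ (for $T\ne T'$) whenever there are $b\in Q_T$, $b'\in Q_{T'}$ and $1\le i<n$ with $f_i(b)=b'$. For a permutation $\pi$ of $[N]$ and an interval $I=[i,i+2m]\subseteq[N]$ with $m\ge 1$, let $\pi|_I$ be the subword of $\pi$ consisting of the letters in $I$; $I$ is a Dyck pattern interval of $\pi$ if the RSK insertion tableau $P(\pi|_I)$ has bottom row $i,i+1,\dots,i+m$ and top row $i+m+1,\dots,i+2m$. *)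

theory Defs
  imports Main
begin

(* Tableaux are lists of rows, FRENCH notation: row 0 is the bottom (longest) row,
   t ! r ! c is the entry in row r, column c (0-indexed). *)

definition is_partition :: "nat list \<Rightarrow> bool" where
  "is_partition lam \<longleftrightarrow> sorted_wrt (\<ge>) lam \<and> 0 \<notin> set lam"

definition psize :: "nat list \<Rightarrow> nat" where
  "psize lam = sum_list lam"

definition has_shape :: "nat list list \<Rightarrow> nat list \<Rightarrow> bool" where
  "has_shape t lam \<longleftrightarrow> map length t = lam"

definition semistandard :: "nat list list \<Rightarrow> bool" where
  "semistandard t \<longleftrightarrow>
     (\<forall>r < length t. sorted (t ! r)) \<and>
     (\<forall>r c. Suc r < length t \<and> c < length (t ! Suc r) \<longrightarrow>
            c < length (t ! r) \<and> t ! r ! c < t ! Suc r ! c)"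

definition SSYT :: "nat list \<Rightarrow> nat \<Rightarrow> nat list list set" where
  "SSYT lam n = {t. has_shape t lam \<and> semistandard t \<and>
                    (\<forall>x \<in> set (concat t). 1 \<le> x \<and> x \<le> n)}"

definition row_word :: "nat list list \<Rightarrow> nat list" where
  "row_word t = concat (rev t)"

definition SYT :: "nat list \<Rightarrow> nat list list set" where
  "SYT lam = {t. has_shape t lam \<and> semistandard t \<and>
                 distinct (row_word t) \<and> set (row_word t) = {1..psize lam}}"

fun split_rows :: "nat list \<Rightarrow> nat list \<Rightarrow> nat list list" where
  "split_rows [] w = []"
| "split_rows (l # ls) w = take l w # split_rows ls (drop l w)"

definition refill :: "nat list list \<Rightarrow> nat list \<Rightarrow> nat list list" where
  "refill t w = rev (split_rows (map length (rev t)) w)"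

(* standardization of a word: letters equal to j are replaced, left to right,
   by a_1+...+a_{j-1}+1, ..., a_1+...+a_j *)
definition std_word :: "nat list \<Rightarrow> nat list" where
  "std_word w = map (\<lambda>k. Suc (card {p. p < length w \<and>
                         (w ! p < w ! k \<or> (w ! p = w ! k \<and> p < k))})) [0..<length w]"

definition std :: "nat list list \<Rightarrow> nat list list" where
  "std b = refill b (std_word (row_word b))"

(* bracketing for the letters i, i+1: scanning left to right, each i+1 is pushed
   (positions), each i closes the most recent unbracketed i+1, otherwise it stays
   unbracketed.  Result: (positions of unbracketed i's, positions of unbracketed i+1's) *)
fun brk :: "nat \<Rightarrow> nat list \<Rightarrow> nat \<Rightarrow> nat list \<Rightarrow> nat list \<Rightarrow> nat list \<times> nat list" where
  "brk i [] k st ui = (ui, st)"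
| "brk i (x # xs) k st ui =
     (if x = Suc i then brk i xs (Suc k) (k # st) ui
      else if x = i then
        (case st of [] \<Rightarrow> brk i xs (Suc k) [] (ui @ [k])
                  | _ # st' \<Rightarrow> brk i xs (Suc k) st' ui)
      else brk i xs (Suc k) st ui)"

(* f_i on words: change the rightmost unbracketed i into i+1; None = \<emptyset> *)
definition f_word :: "nat \<Rightarrow> nat list \<Rightarrow> nat list option" where
  "f_word i w = (let ui = fst (brk i w 0 [] []) in
                 if ui = [] then None else Some (w[last ui := Suc i]))"

(* e_i on words: change the leftmost unbracketed i+1 into i *)
definition e_word :: "nat \<Rightarrow> nat list \<Rightarrow> nat list option" where
  "e_word i w = (let us = snd (brk i w 0 [] []) in
                 if us = [] then None else Some (w[last us := i]))"

definition f_op :: "nat \<Rightarrow> nat list list \<Rightarrow> nat list list option" where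
  "f_op i b = map_option (refill b) (f_word i (row_word b))"

definition e_op :: "nat \<Rightarrow> nat list list \<Rightarrow> nat list list option" where
  "e_op i b = map_option (refill b) (e_word i (row_word b))"

definition Qcr :: "nat list \<Rightarrow> nat \<Rightarrow> nat list list \<Rightarrow> nat list list set" where
  "Qcr lam n T = {b \<in> SSYT lam n. std b = T}"

definition CS_edge :: "nat list \<Rightarrow> nat \<Rightarrow> nat list list \<Rightarrow> nat list list \<Rightarrow> bool" where
  "CS_edge lam n T T' \<longleftrightarrow> T \<in> SYT lam \<and> T' \<in> SYT lam \<and> T \<noteq> T' \<and>
     (\<exists>b \<in> Qcr lam n T. \<exists>b' \<in> Qcr lam n T'. \<exists>i. 1 \<le> i \<and> i < n \<and> f_op i b = Some b')"

fun row_ins :: "nat list list \<Rightarrow> nat \<Rightarrow> nat list list" where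
  "row_ins [] x = [[x]]"
| "row_ins (r # rs) x =
     (let j = length (takeWhile (\<lambda>y. y \<le> x) r) in
      if j = length r then (r @ [x]) # rs
      else (r[j := x]) # row_ins rs (r ! j))"

definition P_tab :: "nat list \<Rightarrow> nat list list" where
  "P_tab w = foldl row_ins [] w"

definition dyck_intervals :: "nat \<Rightarrow> nat list \<Rightarrow> nat set set" where
  "dyck_intervals N pi = {I. \<exists>i m. 1 \<le> m \<and> 1 \<le> i \<and> i + 2 * m \<le> N \<and> I = {i..i + 2 * m} \<and>
       P_tab (filter (\<lambda>x. x \<in> I) pi) = [[i..<i + m + 1], [i + m + 1..<i + 2 * m + 1]]}"

end

theory Submission
  imports Defs
begin

text \<open>
  Let \<open>f\<^sub>i\<close> change the letter at position \<open>p\<close> of the word \<open>v\<close> of \<open>b\<close>, and let \<open>x\<close> be the entry of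
  \<open>w = std v\<close> at \<open>p\<close>. Then \<open>std (f\<^sub>i v)\<close> arises from \<open>w\<close> by the cycle sending \<open>x\<close> to \<open>x + m\<close> and
  decreasing \<open>x + 1, \<dots>, x + m\<close> by one, where \<open>m\<close> is the number of bracketed letters \<open>i\<close>. If \<open>s\<close> letters
  of \<open>v\<close> are at most \<open>i\<close>, then \<open>[s - m, s + m]\<close> is a Dyck pattern interval of \<open>w\<close>, and merging its first
  \<open>m + 1\<close> letters into one letter and its last \<open>m\<close> letters into the next one gives a word with
  standardization \<open>w\<close> on which the operator acts at the same position \<open>p\<close>. So every edge comes from
  a Dyck pattern interval. The interval is recovered from the edge: the cycle determines \<open>x\<close> and \<open>m\<close>, and \<open>s\<close>
  separates the letters among \<open>x + 1, \<dots>, x + m\<close> to the right of \<open>x\<close> from those to its left.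

  A word is a reading word of a semistandard tableau of a given shape iff its standardization is one, so that
  tableaux enter only in the proof that \<open>f\<^sub>i\<close> preserves semistandardness.
\<close>

section \<open>The crystal operator as a first maximum\<close>

text \<open>A predicate on positions rather than on letters: later predicates also ask how often a
  letter has occurred before the position.\<close>

definition cnt :: "(nat \<Rightarrow> bool) \<Rightarrow> nat \<Rightarrow> nat" where
  "cnt P q = card {k. k < q \<and> P k}"

lemma cnt_0 [simp]: "cnt P 0 = 0"
  by (simp add: cnt_def)

lemma cnt_Suc [simp]: "cnt P (Suc q) = cnt P q + (if P q then 1 else 0)"
proof -
  have "{k. k < Suc q \<and> P k} = (if P q then insert q {k. k < q \<and> P k} else {k. k < q \<and> P k})"
    by (auto simp: less_Suc_eq)
  then show ?thesis by (simp add: cnt_def)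
qed

lemma cnt_diff:
  assumes "q \<le> p"
  shows "cnt P p = cnt P q + card {k. q \<le> k \<and> k < p \<and> P k}"
proof -
  have "{k. k < p \<and> P k} = {k. k < q \<and> P k} \<union> {k. q \<le> k \<and> k < p \<and> P k}"
    using assms by auto
  moreover have "card ({k. k < q \<and> P k} \<union> {k. q \<le> k \<and> k < p \<and> P k})
      = card {k. k < q \<and> P k} + card {k. q \<le> k \<and> k < p \<and> P k}"
    by (rule card_Un_disjoint) auto
  ultimately show ?thesis
    by (simp add: cnt_def)
qed

lemma cnt_mono: "q \<le> p \<Longrightarrow> cnt P q \<le> cnt P p"
  by (simp add: cnt_diff)

lemma cnt_cong: "(\<And>k. k < q \<Longrightarrow> P k \<longleftrightarrow> Q k) \<Longrightarrow> cnt P q = cnt Q q"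
  unfolding cnt_def by (metis (mono_tags, lifting))

lemma length_filter_take_eq_cnt:
  "q \<le> length w \<Longrightarrow> length (filter P (take q w)) = cnt (\<lambda>k. P (w ! k)) q"
  by (induction q) (auto simp: take_Suc_conv_app_nth)

text \<open>Reading the letters \<^term>\<open>i\<close> as up-steps and \<^term>\<open>Suc i\<close> as down-steps, \<^term>\<open>p\<close> is the
  step by which the path attains its maximum for the first time.\<close>

definition fpos :: "nat \<Rightarrow> nat list \<Rightarrow> nat \<Rightarrow> bool" where
  "fpos i v p \<longleftrightarrow> p < length v \<and> v ! p = i \<and>
     (\<forall>q\<le>p. cnt (\<lambda>k. v ! k = i) q + cnt (\<lambda>k. v ! k = Suc i) p
            \<le> cnt (\<lambda>k. v ! k = i) p + cnt (\<lambda>k. v ! k = Suc i) q) \<and>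
     (\<forall>q\<le>length v. cnt (\<lambda>k. v ! k = i) q + cnt (\<lambda>k. v ! k = Suc i) p
            \<le> cnt (\<lambda>k. v ! k = i) p + cnt (\<lambda>k. v ! k = Suc i) q + 1)"

text \<open>Call the number of \<open>i\<close> minus the number of \<open>Suc i\<close> in a prefix
  its height. If \<open>p < p'\<close>, the first condition on \<open>p'\<close> puts the height
  before \<open>p'\<close> at least as high as the height after \<open>p\<close>; step
  \<open>p'\<close> then rises above the bound that \<open>p\<close> imposes on the whole
  path.\<close>

lemma fpos_unique:
  assumes "fpos i v p" "fpos i v p'"
  shows "p = p'"
proof -
  have False if "fpos i v p" "fpos i v p'" "p < p'" for p p'
  proof -
    let ?A = "cnt (\<lambda>k. v ! k = i)" and ?B = "cnt (\<lambda>k. v ! k = Suc i)"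
    have "v ! p = i" "v ! p' = i" "p' < length v" using that by (auto simp: fpos_def)
    have "?A (Suc p) + ?B p' \<le> ?A p' + ?B (Suc p)"
      using that by (simp only: fpos_def Suc_le_eq)
    moreover have "?A (Suc p') + ?B p \<le> ?A p + ?B (Suc p') + 1"
      using that \<open>p' < length v\<close> by (simp only: fpos_def Suc_le_eq)
    ultimately show False
      using \<open>v ! p = i\<close> \<open>v ! p' = i\<close> by simp
  qed
  then show ?thesis using assms by (metis linorder_neqE_nat)
qed

lemma brk_append:
  "brk i (xs @ ys) k st ui = (case brk i xs k st ui of (ui', st') \<Rightarrow> brk i ys (k + length xs) st' ui')"
  by (induction i xs k st ui rule: brk.induct) (auto split: list.splits)

text \<open>After each prefix the number of unbracketed \<open>i\<close> is the maximal height
  reached so far, and the size of the stack is the distance of the path below it. The last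
  unbracketed \<open>i\<close> is the step that first reached this maximum.\<close>

lemma brk_invariant:
  fixes v :: "nat list" and i :: nat
  defines "A \<equiv> cnt (\<lambda>k. v ! k = i)" and "B \<equiv> cnt (\<lambda>k. v ! k = Suc i)"
  assumes "n \<le> length v" and "brk i (take n v) 0 [] [] = (ui, st)"
  shows "A n + length st = B n + length ui \<and> (\<forall>q\<le>n. A q \<le> B q + length ui) \<and>
    (ui \<noteq> [] \<longrightarrow> last ui < n \<and> v ! last ui = i \<and> A (last ui) + 1 = B (last ui) + length ui \<and>
       (\<forall>q\<le>last ui. A q + 1 \<le> B q + length ui))"
  using assms(3,4)
proof (induction n arbitrary: ui st)
  case 0
  then show ?case by (simp add: A_def B_def)
next
  case (Suc n)
  obtain u s where us: "brk i (take n v) 0 [] [] = (u, s)" by fastforce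
  note IH = Suc.IH[OF _ us]
  have step: "brk i [v ! n] n s u = (ui, st)"
    using Suc.prems us by (simp add: take_Suc_conv_app_nth brk_append)
  have AS: "A (Suc n) = A n + (if v ! n = i then 1 else 0)"
    and BS: "B (Suc n) = B n + (if v ! n = Suc i then 1 else 0)"
    by (simp_all add: A_def B_def)
  \<comment> \<open>Only an unmatched \<open>i\<close> sets a new maximum; a matched one starts
    strictly below the old maximum.\<close>
  consider (down) "v ! n = Suc i" | (unmatched) "v ! n = i" "s = []"
    | (matched) t ts where "v ! n = i" "s = t # ts" | (other) "v ! n \<noteq> i" "v ! n \<noteq> Suc i"
    by (cases s) auto
  then show ?case
  proof cases
    case down
    then show ?thesis using IH step Suc.prems AS BS by (auto simp: le_Suc_eq)
  next
    case unmatched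
    then have "ui = u @ [n]" "st = []" using step by auto
    then show ?thesis using IH unmatched Suc.prems AS BS by (auto simp: le_Suc_eq)
  next
    case matched
    then show ?thesis using IH step Suc.prems AS BS by (auto simp: le_Suc_eq)
  next
    case other
    then show ?thesis using IH step Suc.prems AS BS by (auto simp: le_Suc_eq)
  qed
qed

text \<open>Without an unbracketed \<open>i\<close> the path never rises above 0, whereas a first
  maximum is a step up from height at least 0. Otherwise the invariant makes the last unbracketed
  \<open>i\<close> a first maximum, and there is only one.\<close>

lemma f_word_eq_Some_iff:
  "f_word i v = Some v' \<longleftrightarrow> (\<exists>p. fpos i v p \<and> v' = v[p := Suc i])"
proof -
  let ?A = "cnt (\<lambda>k. v ! k = i)" and ?B = "cnt (\<lambda>k. v ! k = Suc i)"
  obtain u s where us: "brk i v 0 [] [] = (u, s)" by fastforce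
  have inv: "(\<forall>q\<le>length v. ?A q \<le> ?B q + length u) \<and>
    (u \<noteq> [] \<longrightarrow> last u < length v \<and> v ! last u = i \<and> ?A (last u) + 1 = ?B (last u) + length u \<and>
       (\<forall>q\<le>last u. ?A q + 1 \<le> ?B q + length u))"
    using brk_invariant[of "length v" v i u s] us by simp
  show ?thesis
  proof (cases "u = []")
    case True
    have "\<not> fpos i v p" for p
    proof
      assume p: "fpos i v p"
      then have "?A 0 + ?B p \<le> ?A p + ?B 0" by (simp only: fpos_def)
      moreover have "?A (Suc p) \<le> ?B (Suc p)"
        using inv[THEN conjunct1, rule_format, of "Suc p"] True p
        by (simp add: fpos_def Suc_le_eq del: cnt_Suc)
      ultimately show False using p by (simp add: fpos_def)
    qed
    then show ?thesis using True us by (simp add: f_word_def)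
  next
    case False
    have "?A q + ?B (last u) \<le> ?A (last u) + ?B q" if "q \<le> last u" for q
    proof -
      have "?A q + 1 \<le> ?B q + length u" using inv False that by blast
      then show ?thesis using inv False by linarith
    qed
    moreover have "?A q + ?B (last u) \<le> ?A (last u) + ?B q + 1" if "q \<le> length v" for q
    proof -
      have "?A q \<le> ?B q + length u" using inv that by blast
      then show ?thesis using inv False by linarith
    qed
    ultimately have "fpos i v (last u)"
      using inv False by (simp add: fpos_def)
    then show ?thesis using False us fpos_unique by (auto simp: f_word_def)
  qed
qed

lemma fpos_exists:
  assumes "q \<le> length v" "cnt (\<lambda>k. v ! k = Suc i) q < cnt (\<lambda>k. v ! k = i) q"
  shows "\<exists>p. fpos i v p"
proof -
  obtain u s where us: "brk i v 0 [] [] = (u, s)" by fastforce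
  then have "u \<noteq> []"
    using brk_invariant[of "length v" v i u s] assms by (fastforce simp: not_le)
  then have "f_word i v = Some (v[last u := Suc i])"
    using us by (simp add: f_word_def)
  then show ?thesis using f_word_eq_Some_iff by blast
qed

section \<open>Standardization\<close>

text \<open>The linear order in which standardization numbers the positions: \<open>std_word\<close>
  sends a position to its rank.\<close>

definition precedes :: "nat list \<Rightarrow> nat \<Rightarrow> nat \<Rightarrow> bool" where
  "precedes v p q \<longleftrightarrow> v ! p < v ! q \<or> v ! p = v ! q \<and> p < q"

lemma precedes_linear: "p \<noteq> q \<Longrightarrow> precedes v p q \<longleftrightarrow> \<not> precedes v q p"
  by (auto simp: precedes_def)

lemma length_std_word [simp]: "length (std_word v) = length v"
  by (simp add: std_word_def)

lemma nth_std_word: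
  "k < length v \<Longrightarrow> std_word v ! k = Suc (card {p. p < length v \<and> precedes v p k})"
  by (simp add: std_word_def precedes_def)

lemma std_word_less_iff:
  assumes "p < length v" "q < length v"
  shows "std_word v ! p < std_word v ! q \<longleftrightarrow> precedes v p q"
proof -
  have less: "std_word v ! p < std_word v ! q"
    if "precedes v p q" "p < length v" "q < length v" for p q
  proof -
    have "{k. k < length v \<and> precedes v k p} \<subset> {k. k < length v \<and> precedes v k q}"
      using that by (auto simp: precedes_def)
    then show ?thesis using that by (simp add: nth_std_word psubset_card_mono)
  qed
  show ?thesis
    using less[of p q] less[of q p] precedes_linear[of p q v] assms
    by (cases "p = q") (auto simp: precedes_def)
qed

lemma distinct_std_word: "distinct (std_word v)"
  unfolding distinct_conv_nth length_std_word
  by (metis std_word_less_iff precedes_linear less_irrefl)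

lemma set_std_word: "set (std_word v) = {1..length v}"
proof (rule card_subset_eq)
  have "card {p. p < length v \<and> precedes v p k} < length v" if "k < length v" for k
  proof -
    have "{p. p < length v \<and> precedes v p k} \<subset> {..<length v}"
      using that by (auto simp: precedes_def)
    then show ?thesis using psubset_card_mono[of "{..<length v}"] by simp
  qed
  then show "set (std_word v) \<subseteq> {1..length v}"
    by (auto simp: in_set_conv_nth nth_std_word Suc_le_eq)
  show "card (set (std_word v)) = card {1..length v}"
    by (simp add: distinct_card distinct_std_word)
qed simp

lemma nth_eq_Suc_card_less:
  assumes "distinct w" "set w = {1..length w}" "k < length w"
  shows "w ! k = Suc (card {p. p < length w \<and> w ! p < w ! k})"
proof -
  have "bij_betw ((!) w) {p. p < length w \<and> w ! p < w ! k} {1..<w ! k}"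
  proof (rule bij_betw_imageI)
    show "inj_on ((!) w) {p. p < length w \<and> w ! p < w ! k}"
      using assms(1) by (auto simp: inj_on_def nth_eq_iff_index_eq)
    have "w ! k \<le> length w" using assms by (metis atLeastAtMost_iff nth_mem)
    moreover have "x \<in> (!) w ` {p. p < length w \<and> w ! p < w ! k}"
      if "x \<in> set w" "x < w ! k" for x
      using that by (auto simp: in_set_conv_nth)
    moreover have "1 \<le> w ! p" if "p < length w" for p
      using that assms(2) nth_mem by fastforce
    ultimately show "(!) w ` {p. p < length w \<and> w ! p < w ! k} = {1..<w ! k}"
      unfolding assms(2) by auto
  qed
  then have "card {p. p < length w \<and> w ! p < w ! k} = w ! k - 1"
    by (simp add: bij_betw_same_card)
  moreover have "1 \<le> w ! k" using assms(2,3) nth_mem by fastforce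
  ultimately show ?thesis by simp
qed

text \<open>Both words order the positions linearly, so one implication between the orders already
  makes them equal, and a permutation is determined by the ranks of its entries.\<close>

lemma std_word_eqI:
  assumes "distinct w" "set w = {1..length w}" "length v = length w"
    and "\<And>p q. p < length w \<Longrightarrow> q < length w \<Longrightarrow> precedes v p q \<Longrightarrow> w ! p < w ! q"
  shows "std_word v = w"
proof (rule nth_equalityI)
  fix k assume "k < length (std_word v)"
  then have k: "k < length w" using assms(3) by simp
  have "precedes v p k \<longleftrightarrow> w ! p < w ! k" if "p < length w" for p
    using assms(4)[of p k] assms(4)[of k p] precedes_linear[of p k v] that k
    by (cases "p = k") (auto simp: precedes_def)
  then have "{p. p < length w \<and> precedes v p k} = {p. p < length w \<and> w ! p < w ! k}" by auto
  then show "std_word v ! k = w ! k"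
    using k assms(3) nth_eq_Suc_card_less[OF assms(1,2) k] by (simp add: nth_std_word)
qed (simp add: assms(3))

lemma nth_std_word_eq_cnt:
  assumes "k < length v"
  shows "std_word v ! k
    = Suc (cnt (\<lambda>p. v ! p < v ! k) (length v) + cnt (\<lambda>p. v ! p = v ! k) k)"
proof -
  have "{p. p < length v \<and> precedes v p k}
    = {p. p < length v \<and> v ! p < v ! k} \<union> {p. p < k \<and> v ! p = v ! k}"
    using assms by (auto simp: precedes_def)
  then show ?thesis
    using assms by (simp add: nth_std_word cnt_def card_Un_disjoint disjoint_iff)
qed

section \<open>Effect of a crystal operator on the standardization\<close>

definition shift_cycle :: "nat \<Rightarrow> nat \<Rightarrow> nat \<Rightarrow> nat" where
  "shift_cycle x y z = (if z = x then y else if x < z \<and> z \<le> y then z - 1 else z)"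

text \<open>Only comparisons with position \<open>p\<close> change. The positions that it overtakes
  carry the letters \<open>i\<close> to its right and the letters \<open>Suc i\<close> to its left,
  and \<open>m\<close> is their number. The entry at \<open>p\<close> rises by \<open>m\<close>,
  each overtaken entry drops by one.\<close>

lemma std_word_fpos:
  assumes "fpos i v p"
    and m: "cnt (\<lambda>k. v ! k = i) (length v) + cnt (\<lambda>k. v ! k = Suc i) p
          = cnt (\<lambda>k. v ! k = i) p + 1 + m"
  shows "std_word (v[p := Suc i]) = map (shift_cycle (std_word v ! p) (std_word v ! p + m)) (std_word v)"
proof -
  define v' where "v' = v[p := Suc i]"
  have p: "p < length v" "v ! p = i" using assms by (auto simp: fpos_def)
  have nth: "v' ! k = (if k = p then Suc i else v ! k)" for k
    using p by (cases "k = p") (simp_all add: v'_def)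
  have len: "length v' = length v" by (simp add: v'_def)
  have c1: "cnt (\<lambda>k. v' ! k < Suc i) (length v) + 1
      = cnt (\<lambda>k. v ! k < i) (length v) + cnt (\<lambda>k. v ! k = i) (length v)"
  proof -
    have 1: "{k. k < length v \<and> v' ! k < Suc i} = {k. k < length v \<and> v ! k < Suc i} - {p}"
      by (auto simp: nth)
    have 2: "{k. k < length v \<and> v ! k < Suc i}
        = {k. k < length v \<and> v ! k < i} \<union> {k. k < length v \<and> v ! k = i}" by auto
    have "card {k. k < length v \<and> v ! k < Suc i} > 0"
      using p by (auto simp: card_gt_0_iff)
    then have "cnt (\<lambda>k. v' ! k < Suc i) (length v) + 1 = card {k. k < length v \<and> v ! k < Suc i}"
      unfolding cnt_def 1 using p by (simp add: card_Diff_singleton)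
    also have "\<dots> = cnt (\<lambda>k. v ! k < i) (length v) + cnt (\<lambda>k. v ! k = i) (length v)"
      unfolding cnt_def 2 by (subst card_Un_disjoint) auto
    finally show ?thesis .
  qed
  have c2: "cnt (\<lambda>k. v' ! k = Suc i) p = cnt (\<lambda>k. v ! k = Suc i) p"
    by (rule cnt_cong) (simp add: nth)
  have y: "std_word v' ! p = std_word v ! p + m"
    using nth_std_word_eq_cnt[of p v] nth_std_word_eq_cnt[of p v'] c1 c2 p m
    by (simp add: len nth)
  have other: "std_word v' ! k = shift_cycle (std_word v ! p) (std_word v ! p + m) (std_word v ! k)"
    if k: "k < length v" "k \<noteq> p" for k
  proof -
    let ?L = "{q. q < length v \<and> precedes v q k}" and ?L' = "{q. q < length v \<and> precedes v' q k}"
    have ne: "std_word v ! k \<noteq> std_word v ! p" "std_word v' ! k \<noteq> std_word v' ! p"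
      using k p distinct_std_word[of v] distinct_std_word[of v']
      by (auto simp: nth_eq_iff_index_eq len)
    have less: "std_word v ! p < std_word v ! k \<longleftrightarrow> precedes v p k"
      "std_word v' ! k < std_word v' ! p \<longleftrightarrow> precedes v' k p"
      using k p by (simp_all add: std_word_less_iff len)
    have both: "precedes v p k \<and> precedes v' k p \<longleftrightarrow> precedes v p k \<and> \<not> precedes v' p k"
      using precedes_linear k by blast
    have L': "?L' = (if precedes v p k \<and> precedes v' k p then ?L - {p} else ?L)"
    proof -
      have "q \<noteq> p \<Longrightarrow> precedes v' q k \<longleftrightarrow> precedes v q k" for q
        using k by (simp add: precedes_def nth)
      moreover have "precedes v' p k \<Longrightarrow> precedes v p k"
        using k p by (auto simp: precedes_def nth)
      ultimately have "q \<in> ?L' \<longleftrightarrow> q \<in> (if precedes v p k \<and> precedes v' k p then ?L - {p} else ?L)" for q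
        using both by (cases "q = p") auto
      then show ?thesis by blast
    qed
    have "std_word v' ! k
        = (if precedes v p k \<and> precedes v' k p then std_word v ! k - 1 else std_word v ! k)"
    proof (cases "precedes v p k \<and> precedes v' k p")
      case True
      then have "p \<in> ?L" using p by simp
      then have "Suc (card (?L - {p})) = card ?L" by (intro card_Suc_Diff1) auto
      then show ?thesis using k L' True by (simp only: nth_std_word len if_True) simp
    next
      case False
      then show ?thesis using k L' by (simp only: nth_std_word len if_False)
    qed
    \<comment> \<open>By \<open>ne\<close> the comparisons with the entry at \<open>p\<close> are
      strict, so the overtaken positions are those whose old entry lies among the \<open>m\<close>
      values after that of \<open>p\<close>.\<close>
    then show ?thesis
      using less ne y by (auto simp: shift_cycle_def split: if_splits)
  qed
  show ?thesis
    unfolding v'_def[symmetric]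
  proof (rule nth_equalityI)
    fix k assume "k < length (std_word v')"
    then show "std_word v' ! k
        = map (shift_cycle (std_word v ! p) (std_word v ! p + m)) (std_word v) ! k"
      using other[of k] y by (cases "k = p") (auto simp: len shift_cycle_def)
  qed (simp add: len)
qed

section \<open>Insertion tableaux with two rows\<close>

lemma P_tab_snoc: "P_tab (u @ [x]) = row_ins (P_tab u) x"
  by (simp add: P_tab_def)

lemma row_ins_ne: "row_ins t x \<noteq> []"
  by (cases t) (auto simp: Let_def)

lemma P_tab_eq_Nil_iff: "P_tab u = [] \<longleftrightarrow> u = []"
  by (cases u rule: rev_cases) (simp_all add: P_tab_snoc row_ins_ne P_tab_def[of "[]"])

lemma row_ins_rows_ne: "[] \<notin> set t \<Longrightarrow> [] \<notin> set (row_ins t x)"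
  by (induction t x rule: row_ins.induct) (auto simp: Let_def eq_commute[of "[]"])

text \<open>Distinguishes a missing top row from an empty one when an insertion is undone.\<close>

lemma P_tab_rows_ne: "[] \<notin> set (P_tab u)"
  by (induction u rule: rev_induct) (simp_all add: P_tab_snoc row_ins_rows_ne P_tab_def[of "[]"])

lemma sorted_replace_first_greater:
  assumes "sorted (r :: nat list)" "length (takeWhile (\<lambda>y. y \<le> x) r) < length r"
  shows "sorted (r[length (takeWhile (\<lambda>y. y \<le> x) r) := x])"
proof -
  let ?a = "takeWhile (\<lambda>y. y \<le> x) r"
  have r: "r = ?a @ dropWhile (\<lambda>y. y \<le> x) r" by simp
  obtain y b where d: "dropWhile (\<lambda>y. y \<le> x) r = y # b"
    using assms(2) r by (metis append_Nil2 less_irrefl neq_Nil_conv)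
  then have "\<not> y \<le> x" by (metis hd_dropWhile list.distinct(1) list.sel(1))
  have rab: "r = ?a @ y # b" using r d by simp
  then have "sorted (?a @ y # b)" using assms(1) by simp
  then have "sorted (?a @ x # b)"
    using \<open>\<not> y \<le> x\<close> by (auto simp: sorted_append dest: set_takeWhileD)
  moreover have "r[length ?a := x] = ?a @ x # b"
    by (subst rab) (rule list_update_length)
  ultimately show ?thesis by simp
qed

lemma sorted_append_ge:
  assumes "sorted (r :: nat list)" "length (takeWhile (\<lambda>y. y \<le> x) r) = length r"
  shows "sorted (r @ [x])"
proof -
  have "takeWhile (\<lambda>y. y \<le> x) r = r"
    by (metis assms(2) takeWhile_eq_take take_all order_refl)
  then show ?thesis using assms(1) by (auto simp: sorted_append takeWhile_eq_all_conv)
qed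

text \<open>Locates the bumped entry when an insertion is undone.\<close>

lemma P_tab_bottom_sorted: "P_tab u = r # rs \<Longrightarrow> sorted r"
proof (induction u arbitrary: r rs rule: rev_induct)
  case Nil
  then show ?case by (simp add: P_tab_def)
next
  case (snoc x u)
  show ?case
  proof (cases "P_tab u")
    case Nil
    then show ?thesis using snoc.prems by (auto simp: P_tab_snoc)
  next
    case (Cons a as)
    have "sorted a" by (rule snoc.IH[OF Cons])
    then show ?thesis
      using snoc.prems Cons sorted_replace_first_greater[of a x] sorted_append_ge[of a x]
        le_neq_implies_less[OF length_takeWhile_le[of "\<lambda>y. y \<le> x" a]]
      by (auto simp: P_tab_snoc Let_def split: if_splits)
  qed
qed

text \<open>The insertion tableau of a shuffle of \<open>[i..<i+s]\<close> and \<open>[g..<g+b]\<close>, where \<open>i + s \<le> g\<close>, in which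
  \<open>t\<close> of the large letters have been bumped.\<close>

definition shuffle_tab :: "nat \<Rightarrow> nat \<Rightarrow> nat \<Rightarrow> nat \<Rightarrow> nat \<Rightarrow> nat list list" where
  "shuffle_tab i g s b t = ([i..<i + s] @ [g + t..<g + b]) # (if t = 0 then [] else [[g..<g + t]])"

lemma row_ins_large:
  assumes "i + s \<le> g" "t \<le> b"
  shows "row_ins (shuffle_tab i g s b t) (g + b) = shuffle_tab i g s (Suc b) t"
proof -
  have "takeWhile (\<lambda>y. y \<le> g + b) ([i..<i + s] @ [g + t..<g + b]) = [i..<i + s] @ [g + t..<g + b]"
    using assms by (auto simp: takeWhile_eq_all_conv)
  then show ?thesis using assms unfolding shuffle_tab_def row_ins.simps by (simp only: Let_def) simp
qed

lemma takeWhile_le_upt: "b \<le> Suc c \<Longrightarrow> takeWhile (\<lambda>y. y \<le> c) [a..<b] = [a..<b]"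
  by (auto simp: takeWhile_eq_all_conv)

lemma row_ins_small_append:
  "row_ins (shuffle_tab i g s b b) (i + s) = shuffle_tab i g (Suc s) b b"
  by (simp add: shuffle_tab_def Let_def takeWhile_le_upt)

text \<open>The smallest large letter of the bottom row, \<open>g + t\<close>, is bumped and goes to
  the end of the top row, which holds the smaller large letters.\<close>

lemma row_ins_small_bump:
  assumes "i + s < g" "t < b"
  shows "row_ins (shuffle_tab i g s b t) (i + s) = shuffle_tab i g (Suc s) b (Suc t)"
proof -
  have tw: "takeWhile (\<lambda>y. y \<le> i + s) ([i..<i + s] @ [g + t..<g + b]) = [i..<i + s]"
    using assms by (auto simp: takeWhile_append upt_conv_Cons)
  have top: "row_ins (if t = 0 then [] else [[g..<g + t]]) (g + t) = [[g..<g + Suc t]]"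
    by (simp add: Let_def takeWhile_le_upt)
  have upd: "([i..<i + s] @ [g + t..<g + b])[s := i + s] = [i..<i + Suc s] @ [g + Suc t..<g + b]"
    using assms by (simp add: list_update_append upt_conv_Cons)
  have nth: "([i..<i + s] @ [g + t..<g + b]) ! s = g + t"
    using assms by (simp add: nth_append)
  show ?thesis
    using assms unfolding shuffle_tab_def row_ins.simps tw Let_def
    by (simp only: length_upt add_diff_cancel_left' nth upd top length_append) auto
qed

text \<open>Count small letters as up-steps and large ones as down-steps. A small letter bumps
  exactly when the path is below its maximum, so the number \<open>s - t\<close> of small letters
  that bump nothing is the maximal height. The empty word is set apart because its tableau is
  \<open>[]\<close> and not a single empty row.\<close>

lemma P_tab_shuffle:
  assumes "i + s \<le> g" "filter (\<lambda>x. x < g) u = [i..<i + s]" "filter (\<lambda>x. g \<le> x) u = [g..<g + b]"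
  shows "\<exists>t\<le>s. t \<le> b \<and> (u \<noteq> [] \<longrightarrow> P_tab u = shuffle_tab i g s b t) \<and>
    (\<forall>q\<le>length u. cnt (\<lambda>k. u ! k < g) q \<le> cnt (\<lambda>k. g \<le> u ! k) q + (s - t)) \<and>
    (\<exists>q\<le>length u. cnt (\<lambda>k. u ! k < g) q = cnt (\<lambda>k. g \<le> u ! k) q + (s - t))"
  using assms
proof (induction u arbitrary: s b rule: rev_induct)
  case Nil
  then show ?case by (auto simp: eq_commute[of "[]"])
next
  case (snoc x u)
  let ?A = "cnt (\<lambda>k. u ! k < g)" and ?B = "cnt (\<lambda>k. g \<le> u ! k)"
  let ?A' = "cnt (\<lambda>k. (u @ [x]) ! k < g)" and ?B' = "cnt (\<lambda>k. g \<le> (u @ [x]) ! k)"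
  have AB: "?A' q = ?A q" "?B' q = ?B q" if "q \<le> length u" for q
    using that by (auto intro!: cnt_cong simp: nth_append)
  have AB_Suc: "?A' (Suc (length u)) = ?A (length u) + (if x < g then 1 else 0)"
    "?B' (Suc (length u)) = ?B (length u) + (if g \<le> x then 1 else 0)"
    by (simp_all add: AB)
  have A_len: "?A (length u) = length (filter (\<lambda>x. x < g) u)"
    and B_len: "?B (length u) = length (filter (\<lambda>x. g \<le> x) u)"
    using length_filter_take_eq_cnt[of "length u" u] by simp_all
  have ins: "row_ins (P_tab u) x = row_ins (shuffle_tab i g s' b' t) x"
    if "u \<noteq> [] \<longrightarrow> P_tab u = shuffle_tab i g s' b' t" "filter (\<lambda>x. x < g) u = [i..<i + s']"
      "filter (\<lambda>x. g \<le> x) u = [g..<g + b']" "t \<le> b'" for s' b' t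
    using that by (cases "u = []") (auto simp: shuffle_tab_def P_tab_def eq_commute[of "[]"])
  show ?case
  proof (cases "x < g")
    case True
    then have "filter (\<lambda>x. x < g) u @ [x] = [i..<i + s]" using snoc.prems by simp
    moreover from this obtain s' where s: "s = Suc s'" by (cases s) auto
    ultimately have fu: "filter (\<lambda>x. x < g) u = [i..<i + s']" and x: "x = i + s'" by auto
    have gu: "filter (\<lambda>x. g \<le> x) u = [g..<g + b]" using True snoc.prems by simp
    obtain t where t: "t \<le> s'" "t \<le> b" "u \<noteq> [] \<longrightarrow> P_tab u = shuffle_tab i g s' b t"
      and le: "\<And>q. q \<le> length u \<Longrightarrow> ?A q \<le> ?B q + (s' - t)"
      and attained: "\<exists>q\<le>length u. ?A q = ?B q + (s' - t)"
      using snoc.IH[OF _ fu gu] snoc.prems(1) s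
      by (metis (no_types, lifting) Suc_leD add_Suc_right)
    show ?thesis
    proof (cases "t = b")
      case True
      \<comment> \<open>No large letter is left in the bottom row: \<open>x\<close> bumps nothing,
        and a new maximum is attained at the full word.\<close>
      have "P_tab (u @ [x]) = shuffle_tab i g s b t"
        using ins[OF t(3) fu gu t(2)] row_ins_small_append[of i g s' b] True x s
        by (simp add: P_tab_snoc)
      moreover have "?A' q \<le> ?B' q + (s - t)" if "q \<le> Suc (length u)" for q
        using that le[of q] AB[of q] AB_Suc fu gu A_len B_len s t \<open>x < g\<close>
        by (cases "q = Suc (length u)") (auto simp del: cnt_Suc)
      moreover have "?A' (Suc (length u)) = ?B' (Suc (length u)) + (s - t)"
        using AB_Suc fu gu A_len B_len s t True \<open>x < g\<close> by (auto simp del: cnt_Suc)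
      ultimately show ?thesis using t s by (intro exI[of _ t]) (auto simp del: cnt_Suc)
    next
      case False
      \<comment> \<open>Both \<open>s'\<close> and \<open>t\<close> grow by one, so the maximum and
        its place persist; the height after \<open>x\<close> does not exceed it because
        \<open>t < b\<close>.\<close>
      have "P_tab (u @ [x]) = shuffle_tab i g s b (Suc t)"
        using ins[OF t(3) fu gu t(2)] row_ins_small_bump[of i s' g t b] False t x s \<open>x < g\<close>
        by (simp add: P_tab_snoc)
      moreover have "?A' q \<le> ?B' q + (s - Suc t)" if "q \<le> Suc (length u)" for q
        using that le[of q] AB[of q] AB_Suc fu gu A_len B_len s t False \<open>x < g\<close>
        by (cases "q = Suc (length u)") (auto simp del: cnt_Suc)
      moreover have "\<exists>q\<le>length u. ?A' q = ?B' q + (s - Suc t)"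
        using attained AB s by auto
      ultimately show ?thesis using t s False
        by (intro exI[of _ "Suc t"]) (auto simp del: cnt_Suc intro: le_SucI)
    qed
  next
    case False
    then have "filter (\<lambda>x. g \<le> x) u @ [x] = [g..<g + b]" using snoc.prems by simp
    moreover from this obtain b' where b: "b = Suc b'" by (cases b) auto
    ultimately have gu: "filter (\<lambda>x. g \<le> x) u = [g..<g + b']" and x: "x = g + b'" by auto
    have fu: "filter (\<lambda>x. x < g) u = [i..<i + s]" using False snoc.prems by simp
    obtain t where t: "t \<le> s" "t \<le> b'" "u \<noteq> [] \<longrightarrow> P_tab u = shuffle_tab i g s b' t"
      and le: "\<And>q. q \<le> length u \<Longrightarrow> ?A q \<le> ?B q + (s - t)"
      and attained: "\<exists>q\<le>length u. ?A q = ?B q + (s - t)"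
      using snoc.IH[OF snoc.prems(1) fu gu] by blast
    have "P_tab (u @ [x]) = shuffle_tab i g s b t"
      using ins[OF t(3) fu gu t(2)] row_ins_large[of i s g t b'] t x b snoc.prems(1)
      by (simp add: P_tab_snoc)
    moreover have "?A' q \<le> ?B' q + (s - t)" if "q \<le> Suc (length u)" for q
      using that le[of q] le[of "length u"] AB[of q] AB_Suc False
      by (cases "q = Suc (length u)") (auto simp del: cnt_Suc)
    moreover have "\<exists>q\<le>length u. ?A' q = ?B' q + (s - t)"
      using attained AB by auto
    ultimately show ?thesis using t b
      by (intro exI[of _ t]) (auto simp del: cnt_Suc intro: le_SucI)
  qed
qed

text \<open>The last insertion is undone. Whether it extended the bottom row or bumped an entry, the
  previous tableau is again a \<open>shuffle_tab\<close> with smaller parameters, and the last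
  letter is the next one of its run.\<close>

lemma P_tab_shuffle_conv:
  assumes "P_tab u = shuffle_tab i g s b t" "i + s \<le> g" "t \<le> b"
  shows "filter (\<lambda>x. x < g) u = [i..<i + s] \<and> filter (\<lambda>x. g \<le> x) u = [g..<g + b]"
  using assms
proof (induction u arbitrary: s b t rule: rev_induct)
  case Nil
  then show ?case by (simp add: P_tab_def shuffle_tab_def)
next
  case (snoc x u)
  let ?bot = "[i..<i + s] @ [g + t..<g + b]" and ?top = "if t = 0 then [] else [[g..<g + t]]"
  have ins: "row_ins (P_tab u) x = ?bot # ?top"
    using snoc.prems by (simp add: P_tab_snoc shuffle_tab_def)
  have ge: "i + s \<le> g" "t \<le> b" by fact+
  show ?case
  proof (cases "P_tab u")
    case Nil
    then have "u = []" by (simp add: P_tab_eq_Nil_iff)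
    moreover have bot: "?bot = [x]" and "t = 0"
      using ins Nil by (auto split: if_splits)
    have "length ?bot = 1" by (simp only: bot) simp
    then consider "s = 1" "b = 0" | "s = 0" "b = 1" using \<open>t = 0\<close> by force
    then show ?thesis
      using \<open>u = []\<close> bot \<open>t = 0\<close> ge by cases auto
  next
    case (Cons r rs)
    define j where "j = length (takeWhile (\<lambda>y. y \<le> x) r)"
    have "sorted r" by (rule P_tab_bottom_sorted[OF Cons])
    show ?thesis
    proof (cases "j = length r")
      case True
      then have bot: "?bot = r @ [x]" and rs: "rs = ?top"
        using ins Cons by (simp_all add: j_def)
      show ?thesis
      proof (cases "b = t")
        case True
        then have "0 < s" using bot by (cases s) auto
        then obtain s' where s: "s = Suc s'" by (cases s) auto
        then have "r = [i..<i + s']" "x = i + s'" using bot True by auto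
        then have "P_tab u = shuffle_tab i g s' b t" using Cons rs True by (simp add: shuffle_tab_def)
        then have "filter (\<lambda>x. x < g) u = [i..<i + s'] \<and> filter (\<lambda>x. g \<le> x) u = [g..<g + b]"
          using snoc.IH ge s by simp
        then show ?thesis using \<open>x = i + s'\<close> s ge by auto
      next
        case False
        then obtain b' where b: "b = Suc b'" using ge by (cases b) auto
        then have "?bot = ([i..<i + s] @ [g + t..<g + b']) @ [g + b']" using False ge by simp
        then have "r = [i..<i + s] @ [g + t..<g + b']" "x = g + b'" using bot by auto
        then have "P_tab u = shuffle_tab i g s b' t" using Cons rs by (simp add: shuffle_tab_def)
        then have "filter (\<lambda>x. x < g) u = [i..<i + s] \<and> filter (\<lambda>x. g \<le> x) u = [g..<g + b']"
          using snoc.IH ge b False by simp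
        then show ?thesis using \<open>x = g + b'\<close> b by auto
      qed
    next
      case False
      then have jr: "j < length r" using length_takeWhile_le[of "\<lambda>y. y \<le> x" r] by (simp add: j_def)
      define y where "y = r ! j"
      have "\<not> y \<le> x" using nth_length_takeWhile[of "\<lambda>y. y \<le> x" r] jr by (simp add: j_def y_def)
      have bot: "?bot = r[j := x]" and top: "row_ins rs y = ?top"
        using ins Cons False by (simp_all add: j_def y_def Let_def)
      have "t \<noteq> 0" using top row_ins_ne[of rs y] by (auto split: if_splits)
      then obtain t' where t: "t = Suc t'" by (cases t) auto
      \<comment> \<open>The bumped \<open>y\<close> was appended to the top row, since a further
        bump would have created a third row.\<close>
      have ytop: "y = g + t' \<and> rs = (if t' = 0 then [] else [[g..<g + t']])"
      proof (cases rs)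
        case Nil
        then have "[g..<g + t] = [y]" using top t by simp
        then have "length [g..<g + t] = 1" by (simp only:) simp
        then show ?thesis using Nil \<open>[g..<g + t] = [y]\<close> t by simp
      next
        case (Cons q qs)
        have "q \<noteq> []" using P_tab_rows_ne[of u] \<open>P_tab u = r # rs\<close> Cons by auto
        have "q @ [y] = [g..<g + t] \<and> qs = []"
          using top t Cons row_ins_ne by (auto simp: Let_def split: if_splits)
        then have "q @ [y] = [g..<g + t'] @ [g + t']" "qs = []" using t by auto
        then show ?thesis using Cons \<open>q \<noteq> []\<close> by auto
      qed
      have lenr: "length r = s + (b - t)"
        using arg_cong[OF bot, of length] by simp
      \<comment> \<open>Otherwise \<open>x\<close> would be one of the large letters remaining in
        the bottom row, all of which exceed \<open>y\<close>; but \<open>x < y\<close>.\<close>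
      have js: "j < s"
      proof (rule ccontr)
        assume "\<not> j < s"
        then have "?bot ! j = g + t + (j - s)" using jr lenr by (simp add: nth_append)
        moreover have "?bot ! j = x" unfolding bot using jr by simp
        ultimately show False using \<open>\<not> y \<le> x\<close> ytop t by simp
      qed
      \<comment> \<open>Otherwise a small letter would stand to the right of the large letter
        \<open>y\<close> in the sorted row \<open>r\<close>.\<close>
      have "Suc j = s"
      proof (rule ccontr)
        assume "Suc j \<noteq> s"
        then have "Suc j < s" using js by simp
        then have "?bot ! Suc j = i + Suc j" by (simp add: nth_append)
        moreover have "?bot ! Suc j = r ! Suc j" unfolding bot by simp
        moreover have "r ! j \<le> r ! Suc j"
          using \<open>sorted r\<close> lenr \<open>Suc j < s\<close> by (simp add: sorted_nth_mono)
        ultimately show False using ytop \<open>Suc j < s\<close> ge by (simp add: y_def)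
      qed
      then obtain s' where s: "s = Suc s'" and "j = s'" by auto
      have "x = i + s'"
      proof -
        have "?bot ! j = x" unfolding bot using jr by simp
        then show ?thesis using s \<open>j = s'\<close> by (simp add: nth_append)
      qed
      have "r = ?bot[j := y]" unfolding bot by (simp add: y_def)
      also have "\<dots> = [i..<i + s'] @ [g + t'..<g + b]"
        using s \<open>j = s'\<close> ytop t ge by (simp add: list_update_append upt_conv_Cons)
      finally have "P_tab u = shuffle_tab i g s' b t'"
        using Cons ytop by (simp add: shuffle_tab_def)
      then have "filter (\<lambda>x. x < g) u = [i..<i + s'] \<and> filter (\<lambda>x. g \<le> x) u = [g..<g + b]"
        using snoc.IH ge s t by simp
      then show ?thesis using \<open>x = i + s'\<close> s ge by auto
    qed
  qed
qed


text \<open>The two rows form the \<open>shuffle_tab\<close> with \<open>s = m + 1\<close> and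
  \<open>b = t = m\<close>: all large letters have been bumped. Since \<open>s - t\<close> is the
  maximal height, this says that the height never exceeds 1.\<close>

lemma P_tab_two_rows_iff:
  assumes "1 \<le> m"
  shows "P_tab u = [[i..<i + m + 1], [i + m + 1..<i + 2 * m + 1]] \<longleftrightarrow>
    filter (\<lambda>x. x < i + m + 1) u = [i..<i + m + 1] \<and>
    filter (\<lambda>x. i + m + 1 \<le> x) u = [i + m + 1..<i + 2 * m + 1] \<and>
    (\<forall>q\<le>length u. cnt (\<lambda>k. u ! k < i + m + 1) q \<le> cnt (\<lambda>k. i + m + 1 \<le> u ! k) q + 1)"
    (is "?L \<longleftrightarrow> ?F \<and> ?G \<and> ?C")
proof -
  define g where "g = i + m + 1"
  have tab: "[[i..<i + m + 1], [i + m + 1..<i + 2 * m + 1]] = shuffle_tab i g (m + 1) m m"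
    using assms by (simp add: shuffle_tab_def g_def mult_2 add.assoc)
  have FG: ?F ?G if ?L
    using P_tab_shuffle_conv[of u i g "m + 1" m m] that
    unfolding tab by (simp_all add: g_def mult_2 add.assoc)
  have "?L \<longleftrightarrow> ?C" if ?F ?G
  proof -
    have F: "filter (\<lambda>x. x < g) u = [i..<i + (m + 1)]" and G: "filter (\<lambda>x. g \<le> x) u = [g..<g + m]"
      using that by (simp_all only: g_def mult_2) (simp_all only: ac_simps)
    have "i + (m + 1) \<le> g" by (simp add: g_def)
    obtain t where t: "t \<le> m + 1" "t \<le> m" "u \<noteq> [] \<longrightarrow> P_tab u = shuffle_tab i g (m + 1) m t"
      and le: "\<And>q. q \<le> length u \<Longrightarrow> cnt (\<lambda>k. u ! k < g) q \<le> cnt (\<lambda>k. g \<le> u ! k) q + (m + 1 - t)"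
      and attained: "\<exists>q\<le>length u. cnt (\<lambda>k. u ! k < g) q = cnt (\<lambda>k. g \<le> u ! k) q + (m + 1 - t)"
      using P_tab_shuffle[OF \<open>i + (m + 1) \<le> g\<close> F G] by blast
    have "u \<noteq> []" using \<open>?F\<close> by auto
    then have P: "P_tab u = shuffle_tab i g (m + 1) m t" using t by simp
    have "?L \<longleftrightarrow> t = m"
    proof
      assume ?L
      then have "(if t = 0 then [] else [[g..<g + t]]) = [[g..<g + m]]"
        using P unfolding tab using assms by (auto simp: shuffle_tab_def)
      then have "[g..<g + t] = [g..<g + m]" by (auto split: if_splits)
      then have "length [g..<g + t] = length [g..<g + m]" by (rule arg_cong)
      then show "t = m" by simp
    qed (use P tab in simp)
    also have "\<dots> \<longleftrightarrow> ?C"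
    proof
      assume "t = m"
      then show ?C using le by (simp add: g_def)
    next
      assume C: ?C
      obtain q where "q \<le> length u" "cnt (\<lambda>k. u ! k < g) q = cnt (\<lambda>k. g \<le> u ! k) q + (m + 1 - t)"
        using attained by blast
      moreover have "cnt (\<lambda>k. u ! k < g) q \<le> cnt (\<lambda>k. g \<le> u ! k) q + 1"
        using C \<open>q \<le> length u\<close> by (simp add: g_def)
      ultimately show "t = m" using t by linarith
    qed
    finally show ?thesis .
  qed
  then show ?thesis using FG by blast
qed

section \<open>Tableaux as words\<close>

text \<open>Takes the shape itself where \<open>refill\<close> takes a tableau, and so inverts
  \<open>row_word\<close> on the tableaux of shape \<open>lam\<close>.\<close>

definition fill :: "nat list \<Rightarrow> nat list \<Rightarrow> nat list list" where
  "fill lam w = rev (split_rows (rev lam) w)"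

lemma refill_eq_fill: "has_shape t lam \<Longrightarrow> refill t w = fill lam w"
  by (auto simp: refill_def fill_def has_shape_def rev_map)

lemma split_rows_props:
  "length w = sum_list ls \<Longrightarrow> map length (split_rows ls w) = ls \<and> concat (split_rows ls w) = w"
  by (induction ls w rule: split_rows.induct) auto

lemma split_rows_concat: "split_rows (map length ts) (concat ts) = ts"
  by (induction ts) auto

lemma has_shape_fill: "length w = sum_list lam \<Longrightarrow> has_shape (fill lam w) lam"
  using split_rows_props[of w "rev lam"] by (simp add: has_shape_def fill_def rev_map[symmetric])

lemma row_word_fill [simp]: "length w = sum_list lam \<Longrightarrow> row_word (fill lam w) = w"
  using split_rows_props[of w "rev lam"] by (simp add: row_word_def fill_def)

lemma fill_row_word: "has_shape t lam \<Longrightarrow> fill lam (row_word t) = t"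
  using split_rows_concat[of "rev t"] by (auto simp: has_shape_def fill_def row_word_def rev_map)

lemma length_row_word: "has_shape t lam \<Longrightarrow> length (row_word t) = sum_list lam"
  by (auto simp: has_shape_def row_word_def length_concat rev_map[symmetric])

lemma set_row_word: "set (row_word t) = set (concat t)"
  by (simp add: row_word_def)

text \<open>Position in the reading word at which row \<open>r\<close> starts: the rows above it are read first.\<close>

definition row_start :: "nat list \<Rightarrow> nat \<Rightarrow> nat" where
  "row_start lam r = sum_list (drop (Suc r) lam)"

lemma nth_tableau:
  "has_shape t lam \<Longrightarrow> r < length t \<Longrightarrow> c < length (t ! r) \<Longrightarrow>
    t ! r ! c = row_word t ! (row_start lam r + c)"
proof (induction t arbitrary: lam r)
  case Nil
  then show ?case by simp
next
  case (Cons a t)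
  have shape: "has_shape t (map length t)" by (simp add: has_shape_def)
  have lam: "lam = length a # map length t" using Cons.prems by (simp add: has_shape_def)
  have word: "row_word (a # t) = row_word t @ a" by (simp add: row_word_def)
  show ?case
  proof (cases r)
    case 0
    then show ?thesis
      using lam word length_row_word[OF shape]
      by (simp add: row_start_def nth_append_length_plus flip: length_row_word[OF shape])
  next
    case (Suc r')
    have "(t ! r') ! c = row_word t ! (row_start (map length t) r' + c)"
      using Cons.IH[OF shape] Cons.prems Suc by simp
    moreover have "row_start (map length t) r' + c < length (row_word t)"
    proof -
      have "r' < length t" "c < length (t ! r')" using Cons.prems Suc by simp_all
      then have "drop r' (map length t) = length (t ! r') # drop (Suc r') (map length t)"
        by (simp add: Cons_nth_drop_Suc[symmetric])
      then have "row_start (map length t) r' + c < sum_list (drop r' (map length t))"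
        using \<open>c < length (t ! r')\<close> by (simp add: row_start_def)
      also have "\<dots> \<le> sum_list (map length t)"
        by (metis append_take_drop_id le_add2 sum_list_append)
      finally show ?thesis using length_row_word[OF shape] by simp
    qed
    ultimately show ?thesis
      using lam word Suc by (simp add: row_start_def nth_append)
  qed
qed

lemma row_start_Suc:
  "Suc r < length lam \<Longrightarrow> row_start lam r = row_start lam (Suc r) + lam ! Suc r"
  by (simp add: row_start_def Cons_nth_drop_Suc[symmetric])

lemma row_end_le: "r < length lam \<Longrightarrow> row_start lam r + lam ! r \<le> sum_list lam"
proof -
  assume "r < length lam"
  then have "row_start lam r + lam ! r = sum_list (drop r lam)"
    by (simp add: row_start_def Cons_nth_drop_Suc[symmetric])
  then show ?thesis by (metis append_take_drop_id le_add2 sum_list_append)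
qed

text \<open>Stated through positions of the word, so that standardization and the operator can be
  followed without rebuilding tableaux.\<close>

definition semistandard_word :: "nat list \<Rightarrow> nat list \<Rightarrow> bool" where
  "semistandard_word lam v \<longleftrightarrow>
     (\<forall>r c c'. r < length lam \<longrightarrow> c < c' \<longrightarrow> c' < lam ! r \<longrightarrow>
        v ! (row_start lam r + c) \<le> v ! (row_start lam r + c')) \<and>
     (\<forall>r c. Suc r < length lam \<longrightarrow> c < lam ! Suc r \<longrightarrow>
        v ! (row_start lam r + c) < v ! (row_start lam (Suc r) + c))"

lemma partition_antimono: "is_partition lam \<Longrightarrow> Suc r < length lam \<Longrightarrow> lam ! Suc r \<le> lam ! r"
  by (auto simp: is_partition_def sorted_wrt_iff_nth_less)

lemma semistandard_iff_word:
  assumes "is_partition lam" "has_shape t lam"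
  shows "semistandard t \<longleftrightarrow> semistandard_word lam (row_word t)"
proof -
  have lam: "length t = length lam" "\<And>r. r < length lam \<Longrightarrow> length (t ! r) = lam ! r"
    using assms(2) by (auto simp: has_shape_def)
  have nth: "t ! r ! c = row_word t ! (row_start lam r + c)" if "r < length lam" "c < lam ! r" for r c
    using nth_tableau[OF assms(2)] that lam by simp
  have "(\<forall>r<length t. sorted (t ! r)) \<longleftrightarrow>
    (\<forall>r c c'. r < length lam \<longrightarrow> c < c' \<longrightarrow> c' < lam ! r \<longrightarrow>
        row_word t ! (row_start lam r + c) \<le> row_word t ! (row_start lam r + c'))"
    using nth lam by (auto simp: sorted_wrt_iff_nth_less)
  moreover have "(Suc r < length t \<and> c < length (t ! Suc r) \<longrightarrow>
            c < length (t ! r) \<and> t ! r ! c < t ! Suc r ! c) \<longleftrightarrow>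
     (Suc r < length lam \<longrightarrow> c < lam ! Suc r \<longrightarrow>
        row_word t ! (row_start lam r + c) < row_word t ! (row_start lam (Suc r) + c))" for r c
  proof (cases "Suc r < length lam \<and> c < lam ! Suc r")
    case True
    then have "c < lam ! r" using partition_antimono[OF assms(1), of r] by simp
    then show ?thesis using True nth[of r c] nth[of "Suc r" c] lam by simp
  next
    case False
    then show ?thesis using lam by auto
  qed
  ultimately show ?thesis unfolding semistandard_def semistandard_word_def by simp
qed

text \<open>Standardization breaks ties from left to right. A row is read from left to right, so
  weak inequalities along it are preserved and reflected; the upper of two cells in a column is read
  first, so the same holds for strict inequalities up a column.\<close>

lemma semistandard_word_std:
  assumes "is_partition lam" "length v = sum_list lam"
  shows "semistandard_word lam (std_word v) \<longleftrightarrow> semistandard_word lam v"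
proof -
  have row: "std_word v ! p \<le> std_word v ! q \<longleftrightarrow> v ! p \<le> v ! q"
    if "p < q" "q < length v" for p q
    using that std_word_less_iff[of q v p] by (auto simp: precedes_def not_less[symmetric])
  have col: "std_word v ! p < std_word v ! q \<longleftrightarrow> v ! p < v ! q"
    if "q < p" "p < length v" for p q
    using that std_word_less_iff[of p v q] by (auto simp: precedes_def)
  have "std_word v ! (row_start lam r + c) \<le> std_word v ! (row_start lam r + c')
      \<longleftrightarrow> v ! (row_start lam r + c) \<le> v ! (row_start lam r + c')"
    if "r < length lam" "c < c'" "c' < lam ! r" for r c c'
    using that row_end_le[of r lam] assms(2) by (intro row) auto
  moreover have "std_word v ! (row_start lam r + c) < std_word v ! (row_start lam (Suc r) + c)
      \<longleftrightarrow> v ! (row_start lam r + c) < v ! (row_start lam (Suc r) + c)"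
    if "Suc r < length lam" "c < lam ! Suc r" for r c
    using that row_end_le[of r lam] row_start_Suc[of r lam] assms(2) partition_antimono[OF assms(1), of r]
    by (intro col) auto
  ultimately show ?thesis unfolding semistandard_word_def by (simp cong: imp_cong)
qed

text \<open>Only the cell right of \<open>p\<close> and the cell above it can cause a violation. An
  \<open>i\<close> to the right would push the path above its maximum. A \<open>Suc i\<close> above
  would force a run of \<open>Suc i\<close> above the run of \<open>i\<close> that ends at
  \<open>p\<close>, and the path would have been higher before that run.\<close>

lemma semistandard_word_fpos:
  assumes part: "is_partition lam" and len: "length v = sum_list lam"
    and ss: "semistandard_word lam v" and "fpos i v p"
  shows "semistandard_word lam (v[p := Suc i])"
proof -
  let ?A = "cnt (\<lambda>k. v ! k = i)" and ?B = "cnt (\<lambda>k. v ! k = Suc i)"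
  have p: "p < length v" "v ! p = i"
    and before: "\<And>q. q \<le> p \<Longrightarrow> ?A q + ?B p \<le> ?A p + ?B q"
    and all: "\<And>q. q \<le> length v \<Longrightarrow> ?A q + ?B p \<le> ?A p + ?B q + 1"
    using \<open>fpos i v p\<close> by (auto simp: fpos_def)
  have row: "v ! (row_start lam r + c) \<le> v ! (row_start lam r + c')"
    if "r < length lam" "c \<le> c'" "c' < lam ! r" for r c c'
    using ss that by (cases "c = c'") (auto simp: semistandard_word_def)
  have col: "v ! (row_start lam r + c) < v ! (row_start lam (Suc r) + c)"
    if "Suc r < length lam" "c < lam ! Suc r" for r c
    using ss that by (simp add: semistandard_word_def)
  have nth: "v[p := Suc i] ! k = (if k = p then Suc i else v ! k)" for k
    using p by (cases "k = p") simp_all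
  have row': "Suc i \<le> v ! (row_start lam r + c')"
    if p_eq: "row_start lam r + c = p" and "r < length lam" "c < c'" "c' < lam ! r" for r c c'
  proof -
    have "Suc p < length v" using that len row_end_le[of r lam] by simp
    then have "?A (Suc (Suc p)) + ?B p \<le> ?A p + ?B (Suc (Suc p)) + 1"
      by (intro all) simp
    then have "v ! Suc p \<noteq> i" using p by auto
    moreover have "v ! p \<le> v ! Suc p" using row[of r c "Suc c"] that by simp
    moreover have "v ! Suc p \<le> v ! (row_start lam r + c')" using row[of r "Suc c" c'] that by simp
    ultimately show ?thesis using p by simp
  qed
  have col': "Suc i < v ! (row_start lam (Suc r) + c)"
    if p_eq: "row_start lam r + c = p" and r: "Suc r < length lam" "c < lam ! Suc r" for r c
  proof (rule ccontr)
    assume "\<not> Suc i < v ! (row_start lam (Suc r) + c)"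
    then have above: "v ! (row_start lam (Suc r) + c) = Suc i"
      using col[OF r] p_eq p by simp
    have cr: "c < lam ! r" using partition_antimono[OF part, of r] r by simp
    \<comment> \<open>The leftmost \<open>i\<close> in the row of \<open>p\<close>; the cells above
      columns \<open>c0\<close> to \<open>c\<close> turn out to contain
      \<open>Suc i\<close>.\<close>
    define c0 where "c0 = (LEAST c0. v ! (row_start lam r + c0) = i)"
    have c0: "v ! (row_start lam r + c0) = i" "c0 \<le> c"
      unfolding c0_def using p p_eq by (auto intro: LeastI Least_le)
    have less_c0: "v ! (row_start lam r + c1) \<noteq> i" if "c1 < c0" for c1
      using that not_less_Least unfolding c0_def by blast
    define q where "q = row_start lam (Suc r) + c0"
    have start: "row_start lam r = row_start lam (Suc r) + lam ! Suc r"
      by (rule row_start_Suc[OF r(1)])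
    have "q \<le> p" using p_eq start r c0 by (simp add: q_def)
    \<comment> \<open>Entries of the upper row from column \<open>c0\<close> on exceed
      \<open>i\<close>, so between \<open>q\<close> and \<open>p\<close> every \<open>i\<close> lies
      in the row of \<open>p\<close>, at or after column \<open>c0\<close>.\<close>
    have up: "{k. q \<le> k \<and> k < p \<and> v ! k = i} \<subseteq> {row_start lam r + c0..<p}"
    proof
      fix k assume k: "k \<in> {k. q \<le> k \<and> k < p \<and> v ! k = i}"
      have "\<not> k < row_start lam r"
      proof
        assume "k < row_start lam r"
        then obtain d where d: "k = row_start lam (Suc r) + d" "c0 \<le> d" "d < lam ! Suc r"
          using k start by (intro that[of "k - row_start lam (Suc r)"]) (auto simp: q_def)
        have "i < v ! (row_start lam (Suc r) + c0)" using col[of r c0] c0 r by simp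
        also have "\<dots> \<le> v ! k" using row[of "Suc r" c0 d] d r by simp
        finally show False using k by simp
      qed
      then have "row_start lam r + (k - row_start lam r) = k" by simp
      then have "\<not> k - row_start lam r < c0" using less_c0[of "k - row_start lam r"] k by auto
      then show "k \<in> {row_start lam r + c0..<p}" using k \<open>\<not> k < row_start lam r\<close> by auto
    qed
    \<comment> \<open>Each of these cells lies above an entry at least \<open>i\<close> and weakly
      to the left of the \<open>Suc i\<close> above \<open>p\<close>.\<close>
    have down: "{q..q + (c - c0)} \<subseteq> {k. q \<le> k \<and> k < p \<and> v ! k = Suc i}"
    proof
      fix k assume k: "k \<in> {q..q + (c - c0)}"
      define d where "d = k - row_start lam (Suc r)"
      have d: "k = row_start lam (Suc r) + d" "c0 \<le> d" "d \<le> c"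
        using k c0 by (auto simp: q_def d_def)
      have "i \<le> v ! (row_start lam r + d)" using row[of r c0 d] c0 d cr r by simp
      also have "\<dots> < v ! k" using col[of r d] d r by simp
      finally have "i < v ! k" .
      moreover have "v ! k \<le> Suc i" using row[of "Suc r" d c] d r above by simp
      ultimately show "k \<in> {k. q \<le> k \<and> k < p \<and> v ! k = Suc i}"
        using k d p_eq start r by auto
    qed
    have "card {k. q \<le> k \<and> k < p \<and> v ! k = i} \<le> c - c0"
      using card_mono[OF _ up] p_eq by simp
    moreover have "c - c0 + 1 \<le> card {k. q \<le> k \<and> k < p \<and> v ! k = Suc i}"
      using card_mono[OF _ down] by simp
    \<comment> \<open>From \<open>q\<close> to \<open>p\<close> there are more down-steps than
      up-steps, so the path is higher at \<open>q\<close> than at \<open>p\<close>.\<close>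
    ultimately show False
      using before[OF \<open>q \<le> p\<close>] cnt_diff[OF \<open>q \<le> p\<close>, of "\<lambda>k. v ! k = i"]
        cnt_diff[OF \<open>q \<le> p\<close>, of "\<lambda>k. v ! k = Suc i"] by linarith
  qed
  show ?thesis
    unfolding semistandard_word_def nth
  proof (intro conjI allI impI)
    fix r c c' assume "r < length lam" "c < c'" "c' < lam ! r"
    then show "(if row_start lam r + c = p then Suc i else v ! (row_start lam r + c))
      \<le> (if row_start lam r + c' = p then Suc i else v ! (row_start lam r + c'))"
      using row[of r c c'] row'[of r c c'] p by auto
  next
    fix r c assume "Suc r < length lam" "c < lam ! Suc r"
    then show "(if row_start lam r + c = p then Suc i else v ! (row_start lam r + c))
      < (if row_start lam (Suc r) + c = p then Suc i else v ! (row_start lam (Suc r) + c))"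
      using col[of r c] col'[of r c] p row_start_Suc[of r lam] by auto
  qed
qed

section \<open>Dyck patterns\<close>

text \<open>The insertion tableau condition on \<open>[i, i + 2m]\<close>, restated for the whole
  permutation by prefix counts so that it can be compared with \<open>fpos\<close>.\<close>

definition dyck :: "nat list \<Rightarrow> nat \<Rightarrow> nat \<Rightarrow> bool" where
  "dyck w i m \<longleftrightarrow> 1 \<le> m \<and> 1 \<le> i \<and> i + 2 * m \<le> length w \<and>
     sorted_wrt (<) (filter (\<lambda>x. i \<le> x \<and> x \<le> i + m) w) \<and>
     sorted_wrt (<) (filter (\<lambda>x. i + m < x \<and> x \<le> i + 2 * m) w) \<and>
     (\<forall>q\<le>length w. cnt (\<lambda>k. i \<le> w ! k \<and> w ! k \<le> i + m) q
                 \<le> cnt (\<lambda>k. i + m < w ! k \<and> w ! k \<le> i + 2 * m) q + 1)"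

lemma sorted_wrt_filter_iff:
  "sorted_wrt R (filter P w) \<longleftrightarrow> sorted_wrt (\<lambda>x y. P x \<longrightarrow> P y \<longrightarrow> R x y) w"
  by (induction w) auto

lemma sorted_wrt_filterD:
  assumes "sorted_wrt R (filter P w)" "p < q" "q < length w" "P (w ! p)" "P (w ! q)"
  shows "R (w ! p) (w ! q)"
  using assms unfolding sorted_wrt_filter_iff by (simp add: sorted_wrt_iff_nth_less)

lemma filter_eq_upt_iff:
  assumes "{x \<in> set w. P x} = {a..<b}"
  shows "filter P w = [a..<b] \<longleftrightarrow> sorted_wrt (<) (filter P (w :: nat list))"
proof
  assume "sorted_wrt (<) (filter P w)"
  then have "sorted (filter P w)" "distinct (filter P w)"
    by (simp_all add: strict_sorted_iff)
  then show "filter P w = [a..<b]"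
    using assms by (intro sorted_distinct_set_unique) auto
qed simp

text \<open>Carries the prefix condition from the letters in the interval to the whole word: letters
  outside it only repeat prefixes.\<close>

lemma prefixes_of_filter:
  "(\<forall>q\<le>length (filter P w). Q (take q (filter P w))) \<longleftrightarrow> (\<forall>q\<le>length w. Q (filter P (take q w)))"
proof (induction w rule: rev_induct)
  case Nil
  then show ?case by simp
next
  case (snoc x w)
  have "(\<forall>q\<le>length (w @ [x]). Q (filter P (take q (w @ [x])))) \<longleftrightarrow>
    (\<forall>q\<le>length w. Q (filter P (take q w))) \<and> Q (filter P (w @ [x]))"
    by (auto simp: le_Suc_eq)
  moreover have "(\<forall>q\<le>length (filter P (w @ [x])). Q (take q (filter P (w @ [x])))) \<longleftrightarrow>
    (\<forall>q\<le>length (filter P w). Q (take q (filter P w))) \<and> Q (filter P (w @ [x]))"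
    by (auto simp: le_Suc_eq)
  ultimately show ?case using snoc by simp
qed

lemma P_tab_interval_iff_dyck:
  assumes "set w = {1..length w}" "1 \<le> m" "1 \<le> i" "i + 2 * m \<le> length w"
  shows "P_tab (filter (\<lambda>x. x \<in> {i..i + 2 * m}) w) = [[i..<i + m + 1], [i + m + 1..<i + 2 * m + 1]]
    \<longleftrightarrow> dyck w i m"
proof -
  let ?S = "\<lambda>x. i \<le> x \<and> x \<le> i + m" and ?G = "\<lambda>x. i + m < x \<and> x \<le> i + 2 * m"
  define u where "u = filter (\<lambda>x. x \<in> {i..i + 2 * m}) w"
  have S: "filter (\<lambda>x. x < i + m + 1) (filter (\<lambda>x. x \<in> {i..i + 2 * m}) z) = filter ?S z"
    and G: "filter (\<lambda>x. i + m + 1 \<le> x) (filter (\<lambda>x. x \<in> {i..i + 2 * m}) z) = filter ?G z" for z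
    by (auto simp: filter_filter intro!: filter_cong)
  have "{x \<in> set w. ?S x} = {i..<i + m + 1}" "{x \<in> set w. ?G x} = {i + m + 1..<i + 2 * m + 1}"
    using assms by auto
  then have "filter (\<lambda>x. x < i + m + 1) u = [i..<i + m + 1] \<longleftrightarrow> sorted_wrt (<) (filter ?S w)"
    "filter (\<lambda>x. i + m + 1 \<le> x) u = [i + m + 1..<i + 2 * m + 1] \<longleftrightarrow> sorted_wrt (<) (filter ?G w)"
    unfolding u_def S G by (simp_all only: filter_eq_upt_iff)
  moreover have "(\<forall>q\<le>length u. cnt (\<lambda>k. u ! k < i + m + 1) q \<le> cnt (\<lambda>k. i + m + 1 \<le> u ! k) q + 1)
    \<longleftrightarrow> (\<forall>q\<le>length w. cnt (\<lambda>k. ?S (w ! k)) q \<le> cnt (\<lambda>k. ?G (w ! k)) q + 1)"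
  proof -
    have "(\<forall>q\<le>length u. cnt (\<lambda>k. u ! k < i + m + 1) q \<le> cnt (\<lambda>k. i + m + 1 \<le> u ! k) q + 1)
      \<longleftrightarrow> (\<forall>q\<le>length u. length (filter (\<lambda>x. x < i + m + 1) (take q u))
            \<le> length (filter (\<lambda>x. i + m + 1 \<le> x) (take q u)) + 1)"
      by (simp add: length_filter_take_eq_cnt)
    also have "\<dots> \<longleftrightarrow> (\<forall>q\<le>length w. length (filter ?S (take q w)) \<le> length (filter ?G (take q w)) + 1)"
      unfolding u_def using prefixes_of_filter[where Q = "\<lambda>z. length (filter (\<lambda>x. x < i + m + 1) z)
            \<le> length (filter (\<lambda>x. i + m + 1 \<le> x) z) + 1"] by (simp only: S G)
    also have "\<dots> \<longleftrightarrow> (\<forall>q\<le>length w. cnt (\<lambda>k. ?S (w ! k)) q \<le> cnt (\<lambda>k. ?G (w ! k)) q + 1)"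
      by (simp add: length_filter_take_eq_cnt)
    finally show ?thesis .
  qed
  ultimately show ?thesis
    unfolding u_def[symmetric] P_tab_two_rows_iff[OF assms(2)] dyck_def using assms by simp
qed

lemma dyck_intervals_bij:
  assumes "set w = {1..length w}"
  shows "bij_betw (\<lambda>(i, m). {i..i + 2 * m}) {(i, m). dyck w i m} (dyck_intervals (length w) w)"
proof (rule bij_betw_imageI)
  show "inj_on (\<lambda>(i, m). {i..i + 2 * m}) {(i, m). dyck w i m}"
    by (auto simp: inj_on_def Icc_eq_Icc)
  have "I \<in> dyck_intervals (length w) w \<longleftrightarrow> (\<exists>i m. dyck w i m \<and> I = {i..i + 2 * m})" for I
  proof -
    have "I \<in> dyck_intervals (length w) w \<longleftrightarrow> (\<exists>i m. 1 \<le> m \<and> 1 \<le> i \<and> i + 2 * m \<le> length w \<and>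
      I = {i..i + 2 * m} \<and> P_tab (filter (\<lambda>x. x \<in> {i..i + 2 * m}) w)
        = [[i..<i + m + 1], [i + m + 1..<i + 2 * m + 1]])"
      unfolding dyck_intervals_def by blast
    also have "\<dots> \<longleftrightarrow> (\<exists>i m. dyck w i m \<and> I = {i..i + 2 * m})"
      proof (intro arg_cong[of _ _ Ex] ext)
      fix i m
      show "(1 \<le> m \<and> 1 \<le> i \<and> i + 2 * m \<le> length w \<and> I = {i..i + 2 * m} \<and>
        P_tab (filter (\<lambda>x. x \<in> {i..i + 2 * m}) w) = [[i..<i + m + 1], [i + m + 1..<i + 2 * m + 1]])
        \<longleftrightarrow> dyck w i m \<and> I = {i..i + 2 * m}"
      proof (cases "1 \<le> m \<and> 1 \<le> i \<and> i + 2 * m \<le> length w")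
        case True
        then show ?thesis using P_tab_interval_iff_dyck[OF assms, of m i] by blast
      next
        case False
        then show ?thesis unfolding dyck_def by blast
      qed
    qed
    finally show ?thesis .
  qed
  then show "(\<lambda>(i, m). {i..i + 2 * m}) ` {(i, m). dyck w i m} = dyck_intervals (length w) w"
    by force
qed

section \<open>Merging a Dyck pattern into two letters\<close>

definition collapse :: "nat \<Rightarrow> nat \<Rightarrow> nat \<Rightarrow> nat" where
  "collapse i m z = (if i \<le> z \<and> z \<le> i + m then i else if i + m < z \<and> z \<le> i + 2 * m then Suc i else z)"

lemma collapse_eq_iff:
  assumes "1 \<le> m"
  shows "collapse i m z = i \<longleftrightarrow> i \<le> z \<and> z \<le> i + m"
    and "collapse i m z = Suc i \<longleftrightarrow> i + m < z \<and> z \<le> i + 2 * m"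
  using assms by (auto simp: collapse_def)

text \<open>\<open>collapse\<close> is weakly increasing and creates ties only within either half of
  the interval. The letters of each half increase from left to right, which is how standardization
  breaks ties.\<close>

lemma std_word_collapse:
  assumes "dyck w i m" "distinct w" "set w = {1..length w}"
  shows "std_word (map (collapse i m) w) = w"
proof (rule std_word_eqI[OF assms(2,3)])
  fix p q assume pq: "p < length w" "q < length w" "precedes (map (collapse i m) w) p q"
  consider "collapse i m (w ! p) < collapse i m (w ! q)"
    | "collapse i m (w ! p) = collapse i m (w ! q)" "p < q"
    using pq by (auto simp: precedes_def)
  then show "w ! p < w ! q"
  proof cases
    case 1
    then show ?thesis by (auto simp: collapse_def split: if_splits)
  next
    case 2
    have D: "1 \<le> m" "sorted_wrt (<) (filter (\<lambda>x. i \<le> x \<and> x \<le> i + m) w)"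
      "sorted_wrt (<) (filter (\<lambda>x. i + m < x \<and> x \<le> i + 2 * m) w)"
      using assms(1) by (simp_all add: dyck_def)
    have "w ! p \<noteq> w ! q" using 2 pq assms(2) by (auto simp: nth_eq_iff_index_eq)
    then consider "i \<le> w ! p \<and> w ! p \<le> i + m" "i \<le> w ! q \<and> w ! q \<le> i + m"
      | "i + m < w ! p \<and> w ! p \<le> i + 2 * m" "i + m < w ! q \<and> w ! q \<le> i + 2 * m"
      using 2 D(1) by (auto simp: collapse_def split: if_splits)
    then show ?thesis
      using sorted_wrt_filterD[OF D(2) \<open>p < q\<close> pq(2)] sorted_wrt_filterD[OF D(3) \<open>p < q\<close> pq(2)]
      by cases blast+
  qed
qed simp

lemma dyck_cnt:
  assumes "dyck w i m" "distinct w" "set w = {1..length w}"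
  defines "v \<equiv> map (collapse i m) w"
  shows "cnt (\<lambda>k. v ! k = i) (length w) = m + 1"
    and "cnt (\<lambda>k. v ! k = Suc i) (length w) = m"
    and "\<And>q. q \<le> length w \<Longrightarrow> cnt (\<lambda>k. v ! k = i) q \<le> cnt (\<lambda>k. v ! k = Suc i) q + 1"
proof -
  have D: "1 \<le> m" "1 \<le> i" "i + 2 * m \<le> length w" using assms(1) by (simp_all add: dyck_def)
  have A: "cnt (\<lambda>k. v ! k = i) q = cnt (\<lambda>k. i \<le> w ! k \<and> w ! k \<le> i + m) q"
    and B: "cnt (\<lambda>k. v ! k = Suc i) q = cnt (\<lambda>k. i + m < w ! k \<and> w ! k \<le> i + 2 * m) q"
    if "q \<le> length w" for q
    using that D(1) by (auto intro!: cnt_cong simp: v_def collapse_eq_iff)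
  show "cnt (\<lambda>k. v ! k = i) q \<le> cnt (\<lambda>k. v ! k = Suc i) q + 1" if "q \<le> length w" for q
    using that assms(1) A B by (simp add: dyck_def)
  have len: "cnt (\<lambda>k. P (w ! k)) (length w) = card {x \<in> set w. P x}" for P
    using length_filter_take_eq_cnt[of "length w" w P] distinct_card[of "filter P w"] assms(2)
    by simp
  have "{x \<in> set w. i \<le> x \<and> x \<le> i + m} = {i..i + m}"
    "{x \<in> set w. i + m < x \<and> x \<le> i + 2 * m} = {i + m<..i + 2 * m}"
    using assms(3) D by auto
  then show "cnt (\<lambda>k. v ! k = i) (length w) = m + 1" "cnt (\<lambda>k. v ! k = Suc i) (length w) = m"
    using A[of "length w"] B[of "length w"] len[of "\<lambda>x. i \<le> x \<and> x \<le> i + m"]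
      len[of "\<lambda>x. i + m < x \<and> x \<le> i + 2 * m"] by simp_all
qed

text \<open>The path of the merged word never exceeds height 1 and ends there. Hence its maximum is
  1, and the step that first reaches it starts at height 0.\<close>

lemma dyck_fpos:
  assumes "dyck w i m" "distinct w" "set w = {1..length w}"
  defines "v \<equiv> map (collapse i m) w"
  shows "\<exists>p. fpos i v p"
    and "fpos i v p \<Longrightarrow> cnt (\<lambda>k. v ! k = i) p = cnt (\<lambda>k. v ! k = Suc i) p"
proof -
  let ?A = "cnt (\<lambda>k. v ! k = i)" and ?B = "cnt (\<lambda>k. v ! k = Suc i)"
  note cnts = dyck_cnt[OF assms(1-3), folded v_def]
  have len: "length v = length w" by (simp add: v_def)
  show "\<exists>p. fpos i v p" using cnts len by (intro fpos_exists[of "length w"]) auto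
  show "?A p = ?B p" if p: "fpos i v p"
  proof -
    have "v ! p = i" "p < length w" "?A (length w) + ?B p \<le> ?A p + ?B (length w) + 1"
      using p len by (auto simp: fpos_def)
    moreover have "?A (Suc p) \<le> ?B (Suc p) + 1" using \<open>p < length w\<close> by (intro cnts(3)) simp
    ultimately show ?thesis using cnts(1,2) by simp
  qed
qed

lemma dyck_shift:
  assumes "dyck w i m" "distinct w" "set w = {1..length w}" "fpos i (map (collapse i m) w) p"
  shows "std_word ((map (collapse i m) w)[p := Suc i]) = map (shift_cycle (w ! p) (w ! p + m)) w"
proof -
  have "cnt (\<lambda>k. map (collapse i m) w ! k = i) (length (map (collapse i m) w))
      + cnt (\<lambda>k. map (collapse i m) w ! k = Suc i) p
      = cnt (\<lambda>k. map (collapse i m) w ! k = i) p + 1 + m"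
    using dyck_cnt(1)[OF assms(1-3)] dyck_fpos(2)[OF assms] by simp
  from std_word_fpos[OF assms(4) this] show ?thesis
    by (simp add: std_word_collapse[OF assms(1-3)])
qed

text \<open>The cycle gives \<open>m\<close> and the entry at \<open>p\<close>. If
  \<open>i < i'\<close>, then the letter \<open>i + m + 1\<close>, which is greater than the entry
  at \<open>p\<close>, stands to its left, although both lie in the increasing lower half of the
  second interval.\<close>

lemma dyck_eqI:
  assumes w: "distinct w" "set w = {1..length w}"
    and I: "dyck w i m" "fpos i (map (collapse i m) w) p"
    and I': "dyck w i' m'" "fpos i' (map (collapse i' m') w) p'"
    and eq: "map (shift_cycle (w ! p) (w ! p + m)) w = map (shift_cycle (w ! p') (w ! p' + m')) w"
  shows "i = i' \<and> m = m'"
proof -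
  have m: "1 \<le> m" "1 \<le> m'" using I I' by (simp_all add: dyck_def)
  have p: "p < length w" "p' < length w" using I I' by (simp_all add: fpos_def)
  \<comment> \<open>The moved entry is the only value that the cycle increases, and it increases by
    \<open>m\<close>.\<close>
  have "shift_cycle (w ! p) (w ! p + m) (w ! p) = shift_cycle (w ! p') (w ! p' + m') (w ! p)"
    using eq p by (simp add: map_eq_conv)
  then have x: "w ! p = w ! p'" "m = m'"
    using m by (auto simp: shift_cycle_def split: if_splits)
  then have "p = p'" using w p by (simp add: nth_eq_iff_index_eq)
  have False if I: "dyck w i m" "fpos i (map (collapse i m) w) p"
    and I': "dyck w i' m" "fpos i' (map (collapse i' m) w) p" and "i < i'" for i i'
  proof -
    let ?v = "map (collapse i m) w"
    have small: "i \<le> w ! p" "w ! p \<le> i + m" "i' \<le> w ! p"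
      using I(2) I'(2) p m by (auto simp: fpos_def collapse_eq_iff)
    have D: "1 \<le> i" "i + 2 * m \<le> length w"
      "sorted_wrt (<) (filter (\<lambda>x. i \<le> x \<and> x \<le> i + m) w)"
      "sorted_wrt (<) (filter (\<lambda>x. i + m < x \<and> x \<le> i + 2 * m) w)"
      using I(1) by (simp_all add: dyck_def)
    have D': "sorted_wrt (<) (filter (\<lambda>x. i' \<le> x \<and> x \<le> i' + m) w)"
      using I'(1) by (simp add: dyck_def)
    obtain k where k: "k < length w" "w ! k = i"
      using D w(2) by (metis (no_types, lifting) add_leD1 atLeastAtMost_iff in_set_conv_nth)
    have "k < p"
    proof (rule ccontr)
      assume "\<not> k < p"
      moreover have "k \<noteq> p" using k small \<open>i < i'\<close> by auto
      ultimately have "w ! p < w ! k" using sorted_wrt_filterD[OF D(3), of p k] k small by simp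
      then show False using k small by simp
    qed
    then have "cnt (\<lambda>k. ?v ! k = i) p > 0"
      using k p m by (auto simp: cnt_def card_gt_0_iff collapse_eq_iff intro!: exI[of _ k])
    \<comment> \<open>The height before \<open>p\<close> is 0, so the letter \<open>i\<close> to the
      left of \<open>p\<close> is matched in number by a letter of the upper half.\<close>
    then have "cnt (\<lambda>k. ?v ! k = Suc i) p > 0" using dyck_fpos(2)[OF I(1) w I(2)] by simp
    then obtain l where l: "l < p" "?v ! l = Suc i" by (auto simp: cnt_def card_gt_0_iff)
    then have l': "i + m < w ! l" "w ! l \<le> i + 2 * m" using p m by (auto simp: collapse_eq_iff)
    obtain r where r: "r < length w" "w ! r = i + m + 1"
    proof -
      have "i + m + 1 \<in> set w" using D m w(2) by auto
      then show ?thesis using that by (auto simp: in_set_conv_nth)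
    qed
    have "r \<le> l"
    proof (rule ccontr)
      assume "\<not> r \<le> l"
      then have "w ! l < w ! r" using sorted_wrt_filterD[OF D(4), of l r] r l' m by simp
      then show False using r l' by simp
    qed
    then have "w ! r < w ! p"
      using sorted_wrt_filterD[OF D', of r p] r l p small \<open>i < i'\<close> I'(2) m
      by (simp add: fpos_def collapse_eq_iff)
    then show False using r small by simp
  qed
  then have "i = i'" using I I' x \<open>p = p'\<close> by (metis linorder_neqE_nat)
  then show ?thesis using x by simp
qed

section \<open>The Dyck pattern behind an arbitrary operator step\<close>

lemma cnt_ge_cnt: "cnt (\<lambda>k. P k \<and> h \<le> cnt P k) q = cnt P q - h"
  by (induction q) auto

text \<open>The two counts with a cutoff select a pattern inside \<open>v\<close>: all letters
  \<open>i\<close> but the first \<open>h\<close> become its lower half, the first \<open>m\<close>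
  letters \<open>Suc i\<close> its upper half.\<close>

lemma cnt_cnt_less: "cnt (\<lambda>k. P k \<and> cnt P k < m) q = min (cnt P q) m"
  by (induction q) auto

lemma cnt_add_le:
  assumes "\<And>k. P k \<Longrightarrow> R k" "\<And>k. Q k \<Longrightarrow> R k" "\<And>k. P k \<Longrightarrow> \<not> Q k"
  shows "cnt P q + cnt Q q \<le> cnt R q"
  using assms by (induction q) auto

text \<open>With \<open>h\<close> the height before \<open>p\<close>, the pattern drops the first
  \<open>h\<close> letters \<open>i\<close> and all but the first \<open>m\<close> letters
  \<open>Suc i\<close>. The lower half then has \<open>m + 1\<close> letters, and the new path has
  maximum 1, first reached by step \<open>p\<close>.\<close>

lemma std_word_fpos_dyck:
  fixes v :: "nat list" and i p m :: nat
  defines "A \<equiv> cnt (\<lambda>k. v ! k = i)" and "B \<equiv> cnt (\<lambda>k. v ! k = Suc i)" and "w \<equiv> std_word v"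
  assumes "fpos i v p" and m: "A (length v) + B p = A p + 1 + m" and "1 \<le> m"
  shows "\<exists>j. dyck w j m \<and> fpos j (map (collapse j m) w) p"
proof -
  define N where "N = length v"
  have len: "length w = N" by (simp add: w_def N_def)
  have p: "p < N" "v ! p = i"
    and before: "\<And>q. q \<le> p \<Longrightarrow> A q + B p \<le> A p + B q"
    and all: "\<And>q. q \<le> N \<Longrightarrow> A q + B p \<le> A p + B q + 1"
    using \<open>fpos i v p\<close> by (auto simp: fpos_def A_def B_def N_def)
  define c where "c = cnt (\<lambda>k. v ! k < i) N"
  define h where "h = A p - B p"
  have "B p \<le> A p" using before[of 0] by (simp add: A_def B_def)
  then have Ap: "A p = h + B p" by (simp add: h_def)
  have a: "A N = h + 1 + m" using m Ap by (simp add: N_def)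
  \<comment> \<open>The end of the path is no higher than the maximum \<open>h + 1\<close>, so
    \<open>v\<close> has enough letters \<open>Suc i\<close> for the upper half.\<close>
  have b: "m \<le> B N" using all[of N] a Ap by simp
  have Bp: "B p \<le> m"
  proof -
    have "A (Suc p) \<le> A N" unfolding A_def using p by (intro cnt_mono) simp
    then show ?thesis using p a Ap by (simp add: A_def)
  qed
  have le_i: "cnt (\<lambda>k. v ! k < Suc i) q = cnt (\<lambda>k. v ! k < i) q + A q" for q
    by (induction q) (auto simp: A_def less_Suc_eq)
  have lt_w: "w ! k \<le> c" if "k < N" "v ! k < i" for k
  proof -
    have "cnt (\<lambda>l. v ! l = v ! k) (Suc k) \<le> cnt (\<lambda>l. v ! l = v ! k) N"
      using that by (intro cnt_mono) simp
    moreover have "cnt (\<lambda>l. v ! l < v ! k) N + cnt (\<lambda>l. v ! l = v ! k) N \<le> c"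
      unfolding c_def using that by (intro cnt_add_le) auto
    ultimately show ?thesis using that by (simp add: w_def N_def nth_std_word_eq_cnt)
  qed
  have eq_w: "w ! k = Suc (c + A k)" if "k < N" "v ! k = i" for k
    using that by (simp add: w_def N_def nth_std_word_eq_cnt c_def A_def)
  have Suc_w: "w ! k = Suc (c + A N + B k)" if "k < N" "v ! k = Suc i" for k
    using that le_i[of N] by (simp add: w_def N_def nth_std_word_eq_cnt c_def B_def)
  have gt_w: "c + A N + B N < w ! k" if "k < N" "Suc i < v ! k" for k
  proof -
    have "cnt (\<lambda>l. v ! l < Suc i) N + B N \<le> cnt (\<lambda>l. v ! l < v ! k) N"
      unfolding B_def using that by (intro cnt_add_le) auto
    then show ?thesis using that le_i[of N] by (simp add: w_def N_def nth_std_word_eq_cnt c_def)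
  qed
  \<comment> \<open>Letters below \<open>i\<close> receive the entries up to \<open>c\<close>, and
    the \<open>h\<close> dropped letters \<open>i\<close> the next \<open>h\<close>.\<close>
  define j where "j = c + h + 1"
  have jm: "j + m = c + A N" using a by (simp add: j_def)
  have A_less: "A k < A N" if "k < N" "v ! k = i" for k
  proof -
    have "A (Suc k) \<le> A N" unfolding A_def using that by (intro cnt_mono) simp
    then show ?thesis using that by (simp add: A_def)
  qed
  have small: "j \<le> w ! k \<and> w ! k \<le> j + m \<longleftrightarrow> v ! k = i \<and> h \<le> A k" if "k < N" for k
    using lt_w[OF that] eq_w[OF that] Suc_w[OF that] gt_w[OF that] A_less[OF that] jm
    by (cases "v ! k < i"; cases "v ! k = i"; cases "v ! k = Suc i") (auto simp: j_def)
  have big: "j + m < w ! k \<and> w ! k \<le> j + 2 * m \<longleftrightarrow> v ! k = Suc i \<and> B k < m" if "k < N" for k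
    using lt_w[OF that] eq_w[OF that] Suc_w[OF that] gt_w[OF that] A_less[OF that] jm b
    by (cases "v ! k < i"; cases "v ! k = i"; cases "v ! k = Suc i") auto
  have cnt_small: "cnt (\<lambda>k. j \<le> w ! k \<and> w ! k \<le> j + m) q = A q - h" if "q \<le> N" for q
  proof -
    have "cnt (\<lambda>k. j \<le> w ! k \<and> w ! k \<le> j + m) q = cnt (\<lambda>k. v ! k = i \<and> h \<le> A k) q"
      using that by (intro cnt_cong small) simp
    then show ?thesis unfolding A_def by (simp only: cnt_ge_cnt)
  qed
  have cnt_big: "cnt (\<lambda>k. j + m < w ! k \<and> w ! k \<le> j + 2 * m) q = min (B q) m" if "q \<le> N" for q
  proof -
    have "cnt (\<lambda>k. j + m < w ! k \<and> w ! k \<le> j + 2 * m) q = cnt (\<lambda>k. v ! k = Suc i \<and> B k < m) q"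
      using that by (intro cnt_cong big) simp
    then show ?thesis unfolding B_def by (simp only: cnt_cnt_less)
  qed
  \<comment> \<open>Where \<open>B q\<close> is cut off at \<open>m\<close>, the bound comes from
    \<open>m + 1\<close> being the size of the lower half; elsewhere it is the maximality of
    \<open>h + 1\<close>.\<close>
  have peak: "A q - h \<le> min (B q) m + 1" if "q \<le> N" for q
  proof -
    have "A q \<le> A N" unfolding A_def using that by (rule cnt_mono)
    then show ?thesis using all[OF that] Ap a by (auto simp: min_def)
  qed
  have "dyck w j m"
    unfolding dyck_def
  proof (intro conjI allI impI)
    show "1 \<le> m" by fact
    show "1 \<le> j" by (simp add: j_def)
    have "cnt (\<lambda>k. v ! k < Suc i) N + B N \<le> cnt (\<lambda>_. True) N"
      unfolding B_def by (intro cnt_add_le) auto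
    then show "j + 2 * m \<le> length w" using le_i[of N] jm b len by (simp add: cnt_def c_def)
    have less: "w ! k < w ! l" if "k < l" "l < N" "v ! k = v ! l" for k l
      using that std_word_less_iff[of k v l] by (simp add: precedes_def w_def N_def)
    let ?S = "\<lambda>x. j \<le> x \<and> x \<le> j + m" and ?G = "\<lambda>x. j + m < x \<and> x \<le> j + 2 * m"
    show "sorted_wrt (<) (filter ?S w)"
      unfolding sorted_wrt_filter_iff unfolding sorted_wrt_iff_nth_less len
    proof (intro allI impI)
      fix k l
      assume kl: "k < l" "l < N" "?S (w ! k)" "?S (w ! l)"
      then have "v ! k = v ! l" using small[of k] small[of l] by simp
      then show "w ! k < w ! l" using less kl by blast
    qed
    show "sorted_wrt (<) (filter ?G w)"
      unfolding sorted_wrt_filter_iff unfolding sorted_wrt_iff_nth_less len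
    proof (intro allI impI)
      fix k l
      assume kl: "k < l" "l < N" "?G (w ! k)" "?G (w ! l)"
      then have "v ! k = v ! l" using big[of k] big[of l] by simp
      then show "w ! k < w ! l" using less kl by blast
    qed
    show "cnt (\<lambda>k. j \<le> w ! k \<and> w ! k \<le> j + m) q
        \<le> cnt (\<lambda>k. j + m < w ! k \<and> w ! k \<le> j + 2 * m) q + 1" if "q \<le> length w" for q
      using that peak len by (simp add: cnt_small cnt_big)
  qed
  moreover have "fpos j (map (collapse j m) w) p"
  proof -
    let ?v = "map (collapse j m) w"
    have A': "cnt (\<lambda>k. ?v ! k = j) q = A q - h" if "q \<le> N" for q
    proof -
      have "cnt (\<lambda>k. ?v ! k = j) q = cnt (\<lambda>k. j \<le> w ! k \<and> w ! k \<le> j + m) q"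
        using that len \<open>1 \<le> m\<close> by (intro cnt_cong) (simp add: collapse_eq_iff)
      then show ?thesis using cnt_small[OF that] by simp
    qed
    have B': "cnt (\<lambda>k. ?v ! k = Suc j) q = min (B q) m" if "q \<le> N" for q
    proof -
      have "cnt (\<lambda>k. ?v ! k = Suc j) q = cnt (\<lambda>k. j + m < w ! k \<and> w ! k \<le> j + 2 * m) q"
        using that len \<open>1 \<le> m\<close> by (intro cnt_cong) (simp add: collapse_eq_iff)
      then show ?thesis using cnt_big[OF that] by simp
    qed
    have "?v ! p = j" using small[of p] p len Ap \<open>1 \<le> m\<close> by (simp add: collapse_eq_iff)
    moreover have "A q - h + min (B p) m \<le> A p - h + min (B q) m" if "q \<le> p" for q
    proof -
      have "A q \<le> A p" unfolding A_def using that by (rule cnt_mono)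
      then show ?thesis using before[OF that] Ap Bp by (auto simp: min_def)
    qed
    moreover have "A q - h + min (B p) m \<le> A p - h + min (B q) m + 1" if "q \<le> N" for q
      using peak[OF that] Ap Bp by (simp add: min_def split: if_splits)
    ultimately show ?thesis
      using p len by (simp add: fpos_def A' B')
  qed
  ultimately show ?thesis by blast
qed

section \<open>Edges of the crystal skeleton\<close>

lemma SYT_row_word:
  assumes "T \<in> SYT lam"
  shows "has_shape T lam" "length (row_word T) = sum_list lam" "distinct (row_word T)"
    "set (row_word T) = {1..length (row_word T)}"
  using assms length_row_word[of T lam] by (auto simp: SYT_def psize_def)

text \<open>The memberships in \<open>SSYT\<close> and \<open>SYT\<close> come for free:
  semistandardness passes from \<open>T\<close> to \<open>v\<close>, through the operator, and on to
  the standardization of the result.\<close>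

lemma CS_edge_iff_word:
  assumes part: "is_partition lam" and T: "T \<in> SYT lam"
  shows "CS_edge lam n T T' \<longleftrightarrow> T \<noteq> T' \<and>
    (\<exists>v i p. length v = sum_list lam \<and> set v \<subseteq> {1..n} \<and> std_word v = row_word T \<and>
       1 \<le> i \<and> i < n \<and> fpos i v p \<and> T' = fill lam (std_word (v[p := Suc i])))"
    (is "_ \<longleftrightarrow> _ \<and> ?word")
proof
  assume edge: "CS_edge lam n T T'"
  then obtain b b' i where b: "b \<in> SSYT lam n" "std b = T" and b': "b' \<in> SSYT lam n" "std b' = T'"
    and i: "1 \<le> i" "i < n" and f: "f_op i b = Some b'"
    by (auto simp: CS_edge_def Qcr_def)
  define v where "v = row_word b"
  have shape: "has_shape b lam" "has_shape b' lam" using b b' by (auto simp: SSYT_def)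
  have len: "length v = sum_list lam" using length_row_word[OF shape(1)] by (simp add: v_def)
  have "set v \<subseteq> {1..n}" using b by (auto simp: SSYT_def v_def set_row_word)
  moreover have "std_word v = row_word T"
    using b(2) len by (auto simp: std_def refill_eq_fill[OF shape(1)] v_def)
  moreover obtain p where p: "fpos i v p" "b' = fill lam (v[p := Suc i])"
    using f by (auto simp: f_op_def f_word_eq_Some_iff v_def refill_eq_fill[OF shape(1)])
  moreover have "T' = fill lam (std_word (v[p := Suc i]))"
  proof -
    have "row_word b' = v[p := Suc i]" using p(2) len by simp
    then show ?thesis using b'(2) by (auto simp: std_def refill_eq_fill[OF shape(2)])
  qed
  ultimately have ?word using len i by blast
  then show "T \<noteq> T' \<and> ?word" using edge by (simp add: CS_edge_def)
next
  assume R: "T \<noteq> T' \<and> ?word"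
  then obtain v i p where len: "length v = sum_list lam" and v: "set v \<subseteq> {1..n}" "std_word v = row_word T"
    and i: "1 \<le> i" "i < n" and p: "fpos i v p" and T': "T' = fill lam (std_word (v[p := Suc i]))"
    by blast
  define v' where "v' = v[p := Suc i]"
  have len': "length v' = sum_list lam" by (simp add: v'_def len)
  have shape: "has_shape (fill lam v) lam" "has_shape (fill lam v') lam" "has_shape T' lam"
    using len len' by (simp_all add: has_shape_fill T' v'_def)
  have "semistandard_word lam (row_word T)"
    using T semistandard_iff_word[OF part, of T] by (simp add: SYT_def)
  then have ss: "semistandard_word lam v"
    using semistandard_word_std[OF part len] v(2) by simp
  have ss': "semistandard_word lam v'"
    unfolding v'_def by (rule semistandard_word_fpos[OF part len ss p])
  have "set v' \<subseteq> {1..n}"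
    using set_update_subset_insert[of v p "Suc i"] v(1) i by (auto simp: v'_def)
  then have b': "fill lam v' \<in> SSYT lam n"
    using ss' shape semistandard_iff_word[OF part shape(2)] len' set_row_word[of "fill lam v'"]
    by (auto simp: SSYT_def)
  have b: "fill lam v \<in> SSYT lam n"
    using ss v(1) shape semistandard_iff_word[OF part shape(1)] len set_row_word[of "fill lam v"]
    by (auto simp: SSYT_def)
  have word': "row_word T' = std_word v'" using T' len' by (simp add: v'_def)
  have "T' \<in> SYT lam"
    using shape(3) semistandard_iff_word[OF part shape(3)] ss' semistandard_word_std[OF part len']
    by (simp add: SYT_def word' distinct_std_word set_std_word len' psize_def)
  moreover have "std (fill lam v) = T"
    using len v(2) fill_row_word[of T lam] SYT_row_word(1)[OF T]
    by (simp add: std_def refill_eq_fill[OF shape(1)])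
  moreover have "std (fill lam v') = T'"
    unfolding std_def refill_eq_fill[OF shape(2)] using len' T' by (simp add: v'_def)
  moreover have "f_op i (fill lam v) = Some (fill lam v')"
  proof -
    have "f_word i v = Some v'" using p f_word_eq_Some_iff v'_def by blast
    then show ?thesis using len by (simp add: f_op_def refill_eq_fill[OF shape(1)])
  qed
  ultimately show "CS_edge lam n T T'"
    using R T b b' i unfolding CS_edge_def Qcr_def by blast
qed

lemma fill_inject:
  "length v = sum_list lam \<Longrightarrow> length w = sum_list lam \<Longrightarrow> fill lam v = fill lam w \<longleftrightarrow> v = w"
  by (metis row_word_fill)

text \<open>\<open>H\<close> applies the operator to the merged word and standardizes. Injectivity
  recovers the pattern from the cycle; surjectivity replaces an arbitrary word on the edge by a
  merged one with the same cycle.\<close>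

lemma dyck_edges_bij:
  assumes part: "is_partition lam" and T: "T \<in> SYT lam" and n: "sum_list lam \<le> n"
  defines "w \<equiv> row_word T"
  defines "H \<equiv> \<lambda>(i, m). let x = w ! (THE p. fpos i (map (collapse i m) w) p)
                       in fill lam (map (shift_cycle x (x + m)) w)"
  shows "bij_betw H {(i, m). dyck w i m} {T'. CS_edge lam n T T'}"
proof -
  note w = SYT_row_word[OF T, folded w_def]
  have H: "H (i, m) = fill lam (map (shift_cycle (w ! p) (w ! p + m)) w)"
    if "fpos i (map (collapse i m) w) p" for i m p
    using that fpos_unique by (simp add: H_def Let_def) (metis (mono_tags, lifting) the_equality)
  have T_fill: "T = fill lam w" unfolding w_def by (rule fill_row_word[OF w(1), symmetric])
  have ne: "map (shift_cycle (w ! p) (w ! p + m)) w \<noteq> w" if "p < length w" "1 \<le> m" for p m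
  proof
    assume "map (shift_cycle (w ! p) (w ! p + m)) w = w"
    then have "shift_cycle (w ! p) (w ! p + m) (w ! p) = w ! p" using that(1) by (metis nth_map)
    then show False using that(2) by (simp add: shift_cycle_def)
  qed
  show ?thesis
  proof (rule bij_betw_imageI)
    show "inj_on H {(i, m). dyck w i m}"
    proof (rule inj_onI, clarify)
      fix i m i' m' assume D: "dyck w i m" "dyck w i' m'" and eq: "H (i, m) = H (i', m')"
      obtain p p' where p: "fpos i (map (collapse i m) w) p" "fpos i' (map (collapse i' m') w) p'"
        using dyck_fpos(1)[OF D(1) w(3,4)] dyck_fpos(1)[OF D(2) w(3,4)] by blast
      then have "map (shift_cycle (w ! p) (w ! p + m)) w = map (shift_cycle (w ! p') (w ! p' + m')) w"
        using eq H fill_inject w(2) by simp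
      then show "i = i' \<and> m = m'"
        using dyck_eqI[OF w(3,4) D(1) p(1) D(2) p(2)] by blast
    qed
    show "H ` {(i, m). dyck w i m} = {T'. CS_edge lam n T T'}"
    proof (intro equalityI subsetI)
      fix T' assume "T' \<in> H ` {(i, m). dyck w i m}"
      then obtain i m where D: "dyck w i m" and T': "T' = H (i, m)" by auto
      obtain p where p: "fpos i (map (collapse i m) w) p" using dyck_fpos(1)[OF D w(3,4)] by blast
      have im: "1 \<le> m" "1 \<le> i" "i + 2 * m \<le> length w" using D by (simp_all add: dyck_def)
      have "T' = fill lam (map (shift_cycle (w ! p) (w ! p + m)) w)" using H[OF p] T' by simp
      \<comment> \<open>Merging never increases a letter beyond \<open>sum_list lam\<close>, so the
        alphabet \<open>[n]\<close> is large enough for every pattern.\<close>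
      moreover have "set (map (collapse i m) w) \<subseteq> {1..n}"
        using w(2,4) n im by (auto simp: collapse_def)
      moreover have "p < length w" using p by (simp add: fpos_def)
      then have "fill lam w \<noteq> fill lam (map (shift_cycle (w ! p) (w ! p + m)) w)"
        using ne[of p m] im(1) fill_inject w(2) by force
      moreover have "i < n" using im w(2) n by simp
      ultimately have "CS_edge lam n T T'"
        unfolding CS_edge_iff_word[OF part T] w_def[symmetric]
        using dyck_shift[OF D w(3,4) p] std_word_collapse[OF D w(3,4)] w(2) im p T_fill
        by (metis length_map)
      then show "T' \<in> {T'. CS_edge lam n T T'}" by simp
    next
      fix T' assume "T' \<in> {T'. CS_edge lam n T T'}"
      then obtain v i p where "T \<noteq> T'" and len: "length v = sum_list lam"
        and v: "std_word v = w" and p: "fpos i v p" and T': "T' = fill lam (std_word (v[p := Suc i]))"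
        using CS_edge_iff_word[OF part T] unfolding w_def by auto
      let ?A = "cnt (\<lambda>k. v ! k = i)" and ?B = "cnt (\<lambda>k. v ! k = Suc i)"
      have "p < length v" "v ! p = i" using p by (simp_all add: fpos_def)
      have "?A (Suc p) \<le> ?A (length v)" using \<open>p < length v\<close> by (intro cnt_mono) simp
      then have m: "?A (length v) + ?B p = ?A p + 1 + (?A (length v) + ?B p - ?A p - 1)"
        using \<open>v ! p = i\<close> by simp
      define m where "m = ?A (length v) + ?B p - ?A p - 1"
      note m = m[folded m_def]
      have T'_eq: "T' = fill lam (map (shift_cycle (w ! p) (w ! p + m)) w)"
        using std_word_fpos[OF p m] T' v by simp
      \<comment> \<open>For \<open>m = 0\<close> the operator leaves the standardization unchanged
        and yields no edge.\<close>
      have "1 \<le> m"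
      proof (rule ccontr)
        assume "\<not> 1 \<le> m"
        then have "map (shift_cycle (w ! p) (w ! p + m)) w = w"
          by (intro map_idI) (simp add: shift_cycle_def)
        then show False using \<open>T \<noteq> T'\<close> T'_eq T_fill by simp
      qed
      then obtain j where "dyck w j m" "fpos j (map (collapse j m) w) p"
        using std_word_fpos_dyck[OF p m] v by auto
      then show "T' \<in> H ` {(i, m). dyck w i m}"
        using H T'_eq by (metis (mono_tags, lifting) case_prodI image_eqI mem_Collect_eq)
    qed
  qed
qed

lemma bij_betw_dependent_pairs:
  assumes "\<And>x. x \<in> X \<Longrightarrow> bij_betw (g x) (A x) (B x)"
  shows "bij_betw (\<lambda>(x, y). (x, g x y)) (Sigma X A) (Sigma X B)"
proof (rule bij_betw_imageI)
  show "inj_on (\<lambda>(x, y). (x, g x y)) (Sigma X A)"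
    using assms by (auto simp: inj_on_def bij_betw_def)
  show "(\<lambda>(x, y). (x, g x y)) ` Sigma X A = Sigma X B"
    using assms by (force simp: bij_betw_def)
qed

theorem theorem3p9:
  fixes lam :: "nat list" and N n :: nat
  assumes "is_partition lam" and "psize lam = N" and "N \<le> n"
  shows "(\<forall>T \<in> SYT lam. \<exists>g. bij_betw g {T'. CS_edge lam n T T'} (dyck_intervals N (row_word T)))
       \<and> (\<exists>g. bij_betw g {(T, T'). CS_edge lam n T T'}
                          {(T, I). T \<in> SYT lam \<and> I \<in> dyck_intervals N (row_word T)})"
proof -
  have N: "N = sum_list lam" using assms(2) by (simp add: psize_def)
  have local: "\<exists>g. bij_betw g {T'. CS_edge lam n T T'} (dyck_intervals N (row_word T))"
    if T: "T \<in> SYT lam" for T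
  proof -
    have "sum_list lam \<le> n" using assms(3) N by simp
    \<comment> \<open>Pairs \<open>(i, m)\<close> mediate: the map from pairs to edges is inverted
      and followed by the map from pairs to intervals.\<close>
    from bij_betw_inv_into[OF dyck_edges_bij[OF assms(1) T this]]
      dyck_intervals_bij[OF SYT_row_word(4)[OF T]]
    show ?thesis
      unfolding SYT_row_word(2)[OF T] N[symmetric] by (blast intro: bij_betw_trans)
  qed
  then obtain g where g: "\<And>T. T \<in> SYT lam \<Longrightarrow>
      bij_betw (g T) {T'. CS_edge lam n T T'} (dyck_intervals N (row_word T))"
    by metis
  have "{(T, T'). CS_edge lam n T T'} = Sigma (SYT lam) (\<lambda>T. {T'. CS_edge lam n T T'})"
    by (auto simp: CS_edge_def)
  moreover have "{(T, I). T \<in> SYT lam \<and> I \<in> dyck_intervals N (row_word T)}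
      = Sigma (SYT lam) (\<lambda>T. dyck_intervals N (row_word T))"
    by auto
  ultimately show ?thesis
    using local bij_betw_dependent_pairs[of "SYT lam" g, OF g] by auto
qed

end
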